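(* Let $q$ be any prime power and let $a,b$ be distinct positive integers with $a\mid b$ and $b\mid (q-1)$. Then $\mathscr{C}_a(q)\neq\mathscr{C}_b(q)$, except in the following cases, where equality holds: $(q,a,b)\in\{(3,1,2),\,(4,1,3),\,(5,1,2),\,(5,1,4),\,(5,2,4),\,(7,1,3)\}$ (that is, $\mathscr{C}_1(3)=\mathscr{C}_2(3)$, $\mathscr{C}_1(4)=\mathscr{C}_3(4)$, $\mathscr{C}_1(5)=\mathscr{C}_2(5)=\mathscr{C}_4(5)$ and $\mathscr{C}_1(7)=\mathscr{C}_3(7)$).
   Context: Let $\mathbb{F}_q$ be the finite field of order $q$. An orthomorphism over $\mathbb{F}_q$ is a permutation $\theta$ of $\mathbb{F}_q$ such that $x\mapsto\theta(x)-x$ is also a permutation of $\mathbb{F}_q$. For a positive integer $k$ dividing $q-1$, fix a generator $g$ of the cyclic group $\mathbb{F}_q^*$ and let the cyclotomy classes of index $k$ be $C_{k,i}=\{g^j : j\equiv i \pmod k\}$ for $0\le i<k$ (so $C_{k,0}$ is the unique subgroup of index $k$ in $\mathbb{F}_q^*$ and the $C_{k,i}$ are its cosets). A cyclotomic map of index $k$ with multipliers $[a_0,\dots,a_{k-1}]$ ($a_i\in\mathbb{F}_q$) is the map $\theta(0)=0$, $\theta(x)=a_ix$ for $x\in C_{k,i}$. A cyclotomic orthomorphism of index $k$ is an orthomorphism that is a cyclotomic map of index $k$, and $\mathscr{C}_k(q)$ denotes the set of all cyclotomic orthomorphisms of index $k$ over $\mathbb{F}_q$. *)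

theory Defs
  imports "HOL-Library.Cardinality" "HOL-Number_Theory.Number_Theory"
begin

definition orthomorphism :: "('a::field \<Rightarrow> 'a) \<Rightarrow> bool" where
  "orthomorphism \<theta> \<longleftrightarrow> bij \<theta> \<and> bij (\<lambda>x. \<theta> x - x)"

definition generates_units :: "'a::field \<Rightarrow> bool" where
  "generates_units g \<longleftrightarrow> range (\<lambda>j::nat. g ^ j) = UNIV - {0}"

definition cyclotomy_class :: "'a::field \<Rightarrow> nat \<Rightarrow> nat \<Rightarrow> 'a set" where
  "cyclotomy_class g k i = {g ^ j | j::nat. [j = i] (mod k)}"

(* Only the values m 0, ..., m (k - 1) of the multiplier sequence m matter. *)
definition cyclotomic_map :: "'a::field \<Rightarrow> nat \<Rightarrow> (nat \<Rightarrow> 'a) \<Rightarrow> ('a \<Rightarrow> 'a) \<Rightarrow> bool" where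
  "cyclotomic_map g k m \<theta> \<longleftrightarrow>
     \<theta> 0 = 0 \<and> (\<forall>i<k. \<forall>x\<in>cyclotomy_class g k i. \<theta> x = m i * x)"

definition cyclotomic_orthomorphisms :: "'a::field \<Rightarrow> nat \<Rightarrow> ('a \<Rightarrow> 'a) set" where
  "cyclotomic_orthomorphisms g k =
     {\<theta>. orthomorphism \<theta> \<and> (\<exists>m. cyclotomic_map g k m \<theta>)}"

end

theory Submission
  imports Defs "HOL-Combinatorics.Permutations" "HOL-Library.FuncSet"
begin

text \<open>With \<open>M = q - 1\<close>, the cyclotomic orthomorphisms of index \<open>k\<close> are the orthomorphisms that fix 0
  and commute with multiplication by the \<open>(M / k)\<close>-th roots of unity. Let \<open>n = M / b\<close> and
  \<open>N = M / a\<close>, so that \<open>n\<close> properly divides \<open>N\<close>; an orthomorphism is wanted that commutes with the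
  \<open>n\<close>-th but not with the \<open>N\<close>-th roots of unity.

  If the group \<open>K\<close> of \<open>m\<close>-th roots of unity has order at least 3, take \<open>r \<noteq> r'\<close> in \<open>K - {1}\<close>,
  \<open>c = (1 - r') / (r - r')\<close> and \<open>d = r c\<close>. Then \<open>d / c\<close> and \<open>(d - 1) / (c - 1)\<close> are in \<open>K\<close>, so the linear
  map \<open>c x\<close> remains an orthomorphism when it is replaced by \<open>d x + (d - c) z\<close> on a translate \<open>K - z\<close>.
  With \<open>z = 0\<close> this settles \<open>n \<ge> 3\<close>. For \<open>n = 1\<close> and \<open>n = 2\<close> one uses the translates \<open>K - z\<close>,
  respectively \<open>K - z\<close> and \<open>- K + z\<close>: a union of cosets of the \<open>N\<close>-th roots of unity has vanishing sum
  (or sum of squares), and these sets do not.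

  This leaves \<open>n = 1\<close> with \<open>q\<close> even, and \<open>n = 2\<close> with \<open>q = 9\<close> or \<open>q = 2 l + 1\<close> for a prime \<open>l\<close>.
  In characteristic 2 and 3 additive maps do the job. For \<open>q = 2 l + 1 > 7\<close> prime, a nonlinear odd orthomorphism
  comes from a signed count: summing a product of two alternating sums (Vandermonde determinants) with
  polynomial weights over all odd maps picks out the odd orthomorphisms, and its value can be
  found by expanding the determinants. If all odd orthomorphisms were linear, two of these values
  would be incompatible.\<close>

section \<open>Finite fields\<close>

lemma CARD_field_ge_2: "CARD('a::finite_field) \<ge> 2"
proof -
  have "card {0, 1 :: 'a} \<le> CARD('a)"
    by (rule card_mono) auto
  then show ?thesis by simp
qed

lemma of_nat_CARD [simp]: "of_nat (CARD('a)) = (0 :: 'a::finite_field)"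
  by (simp add: CHAR_dvd_CARD of_nat_eq_0_iff_char_dvd)

lemma of_nat_CARD_minus_1: "of_nat (CARD('a) - 1) = (-1 :: 'a::finite_field)"
  using CARD_field_ge_2[where 'a='a] by (simp add: of_nat_diff)

text \<open>A divisor of \<open>q - 1\<close> divides \<open>-1\<close> in the field. This makes the
  order of a group of roots of unity nonzero in the field when translates of the group are
  summed.\<close>

lemma of_nat_dvd_CARD_minus_1_neq_0:
  assumes "n dvd CARD('a::finite_field) - 1"
  shows "of_nat n \<noteq> (0 :: 'a)"
proof
  assume "of_nat n = (0 :: 'a)"
  moreover obtain k where "CARD('a) - 1 = n * k" using assms by (auto elim: dvdE)
  ultimately have "of_nat (CARD('a) - 1) = (0 :: 'a)" by simp
  then show False by (simp add: of_nat_CARD_minus_1)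
qed

lemma power_CARD_minus_1:
  fixes x :: "'a::finite_field"
  assumes "x \<noteq> 0"
  shows "x ^ (CARD('a) - 1) = 1"
proof -
  have "x * x ^ (CARD('a) - 1) = x ^ CARD('a)"
    using CARD_field_ge_2[where 'a='a] by (cases "CARD('a)") auto
  also have "\<dots> = x" by (rule finite_field_power_card_eq_same)
  finally show ?thesis using assms by simp
qed

lemma generates_units_neq_0:
  fixes g :: "'a::field"
  assumes "generates_units g"
  shows "g \<noteq> 0"
proof -
  have "g ^ 1 \<in> UNIV - {0}"
    using assms unfolding generates_units_def by blast
  then show ?thesis by simp
qed

lemma generates_units_obtain:
  fixes g x :: "'a::field"
  assumes "generates_units g" "x \<noteq> 0"
  obtains j where "x = g ^ j"
  using assms unfolding generates_units_def by blast

text \<open>The first \<open>q - 1\<close> powers of \<open>g\<close> already exhaust the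
  \<open>q - 1\<close> units, so they are distinct and \<open>g\<close> has order exactly
  \<open>q - 1\<close>.\<close>

lemma generates_units_power_eq_1_iff:
  fixes g :: "'a::finite_field"
  assumes "generates_units g"
  shows "g ^ i = 1 \<longleftrightarrow> (CARD('a) - 1) dvd i"
proof -
  define M where "M = CARD('a) - 1"
  have M: "M > 0" using CARD_field_ge_2[where 'a='a] by (simp add: M_def)
  have mod: "g ^ i = g ^ (i mod M)" for i
  proof -
    have "g ^ i = g ^ (M * (i div M) + i mod M)" by simp
    also have "\<dots> = (g ^ M) ^ (i div M) * g ^ (i mod M)" by (simp only: power_add power_mult)
    finally show ?thesis
      using power_CARD_minus_1[OF generates_units_neq_0[OF assms]] by (simp add: M_def)
  qed
  have "(\<lambda>j. g ^ j) ` {..<M} = UNIV - {0}"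
  proof -
    have "g ^ j \<in> (\<lambda>j. g ^ j) ` {..<M}" for j
    proof -
      have "j mod M \<in> {..<M}" using M by simp
      then show ?thesis using mod[of j] by (rule rev_image_eqI)
    qed
    then have "range (\<lambda>j. g ^ j) \<subseteq> (\<lambda>j. g ^ j) ` {..<M}" by (rule image_subsetI)
    then have "(\<lambda>j. g ^ j) ` {..<M} = range (\<lambda>j. g ^ j)" by (intro equalityI) auto
    also have "\<dots> = UNIV - {0}" using assms by (simp add: generates_units_def)
    finally show ?thesis .
  qed
  moreover have "card (UNIV - {0 :: 'a}) = M" by (simp add: M_def)
  ultimately have inj: "inj_on (\<lambda>j. g ^ j) {..<M}"
    by (intro eq_card_imp_inj_on) auto
  have "g ^ i = 1 \<longleftrightarrow> i mod M = 0"
  proof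
    assume "g ^ i = 1"
    then have "g ^ (i mod M) = g ^ 0" using mod[of i] by simp
    then show "i mod M = 0" using inj_onD[OF inj] M by auto
  qed (use mod[of i] in simp)
  then show ?thesis by (simp add: M_def dvd_eq_mod_eq_0)
qed

text \<open>Substituting \<open>g * u\<close> for \<open>u\<close> scales the sum by
  \<open>g ^ t\<close>, so it vanishes unless \<open>q - 1\<close> divides \<open>t\<close>. The
  bound on \<open>t\<close> leaves only \<open>t = 0\<close> and \<open>t = q - 1\<close>.\<close>

lemma sum_power_UNIV:
  fixes g :: "'a::finite_field"
  assumes "generates_units g" "t < 2 * (CARD('a) - 1)"
  shows "(\<Sum>u\<in>(UNIV :: 'a set). u ^ t) = (if t = CARD('a) - 1 then -1 else 0)"
proof (cases "(CARD('a) - 1) dvd t")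
  case True
  then obtain k where k: "t = (CARD('a) - 1) * k" by (auto elim: dvdE)
  with assms(2) have "k < 2" by (metis mult.commute mult_less_cancel2)
  then consider "t = 0" | "t = CARD('a) - 1" using k by (auto simp: less_2_cases_iff)
  then show ?thesis
  proof cases
    \<comment> \<open>Since \<open>0 ^ 0 = 1\<close>, all \<open>q\<close> terms are 1 and the sum
      is \<open>q = 0\<close>.\<close>
    case 1
    then show ?thesis using CARD_field_ge_2[where 'a='a] by simp
  next
    case 2
    have "(\<Sum>u\<in>(UNIV :: 'a set). u ^ t) = (\<Sum>u\<in>(UNIV :: 'a set). if u = 0 then 0 else 1)"
      by (rule sum.cong) (use 2 CARD_field_ge_2[where 'a='a] in \<open>auto simp: power_CARD_minus_1[simplified]\<close>)
    also have "\<dots> = (\<Sum>u\<in>UNIV - {0 :: 'a}. 1)"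
      by (rule sum.mono_neutral_cong_right) auto
    also have "\<dots> = of_nat (CARD('a) - 1)" by simp
    finally show ?thesis using 2 of_nat_CARD_minus_1[where 'a='a] by simp
  qed
next
  case False
  then have ne: "g ^ t \<noteq> 1" by (simp add: generates_units_power_eq_1_iff[OF assms(1)])
  have "(\<Sum>u\<in>(UNIV :: 'a set). u ^ t) = (\<Sum>u\<in>UNIV. (g * u) ^ t)"
    by (rule sum.reindex_bij_witness[of _ "\<lambda>u. g * u" "\<lambda>u. u / g"])
       (auto simp: generates_units_neq_0[OF assms(1)])
  also have "\<dots> = g ^ t * (\<Sum>u\<in>(UNIV :: 'a set). u ^ t)"
    by (simp add: power_mult_distrib sum_distrib_left)
  finally show ?thesis using ne False by auto
qed

text \<open>After binomial expansion all exponents of \<open>u\<close> stay below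
  \<open>2 * (q - 1)\<close>, so only the term with exponent \<open>q - 1\<close> survives. All
  moments below are evaluated this way.\<close>

lemma sum_power_times_power_diff_UNIV:
  fixes g x :: "'a::finite_field"
  assumes g: "generates_units g" and km: "k + m < 2 * (CARD('a) - 1)"
  shows "(\<Sum>u\<in>(UNIV :: 'a set). u ^ k * (u - x) ^ m) =
    (if k + m < CARD('a) - 1 then 0
     else - (of_nat (m choose (k + m - (CARD('a) - 1))) * (- x) ^ (k + m - (CARD('a) - 1))))"
proof -
  define M where "M = CARD('a) - 1"
  have "(\<Sum>u\<in>(UNIV :: 'a set). u ^ k * (u - x) ^ m) =
      (\<Sum>u\<in>UNIV. \<Sum>j\<le>m. (of_nat (m choose j) * (- x) ^ j) * u ^ (k + m - j))"
  proof (intro sum.cong refl)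
    fix u :: 'a
    have "(u - x) ^ m = (\<Sum>j\<le>m. of_nat (m choose j) * (- x) ^ j * u ^ (m - j))"
      using binomial_ring[of "- x" u m] by simp
    then have "u ^ k * (u - x) ^ m = (\<Sum>j\<le>m. u ^ k * (of_nat (m choose j) * (- x) ^ j * u ^ (m - j)))"
      by (simp add: sum_distrib_left)
    also have "\<dots> = (\<Sum>j\<le>m. (of_nat (m choose j) * (- x) ^ j) * u ^ (k + m - j))"
    proof (intro sum.cong refl)
      fix j assume "j \<in> {..m}"
      then have "k + m - j = k + (m - j)" by simp
      then show "u ^ k * (of_nat (m choose j) * (- x) ^ j * u ^ (m - j)) =
          (of_nat (m choose j) * (- x) ^ j) * u ^ (k + m - j)"
        by (simp only: power_add mult_ac)
    qed
    finally show "u ^ k * (u - x) ^ m = (\<Sum>j\<le>m. (of_nat (m choose j) * (- x) ^ j) * u ^ (k + m - j))" .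
  qed
  also have "\<dots> = (\<Sum>j\<le>m. (of_nat (m choose j) * (- x) ^ j) * (\<Sum>u\<in>(UNIV :: 'a set). u ^ (k + m - j)))"
    by (subst sum.swap) (simp add: sum_distrib_left)
  also have "\<dots> = (\<Sum>j\<le>m. if j + M = k + m then - (of_nat (m choose j) * (- x) ^ j) else 0)"
    by (intro sum.cong refl) (use km in \<open>auto simp: sum_power_UNIV[OF g] M_def\<close>)
  also have "\<dots> = (if k + m < M then 0
     else - (of_nat (m choose (k + m - M)) * (- x) ^ (k + m - M)))"
  proof (cases "k + m < M")
    case True
    then show ?thesis by (auto intro!: sum.neutral)
  next
    case False
    then have "(\<Sum>j\<le>m. if j + M = k + m then - (of_nat (m choose j) * (- x) ^ j) else 0) =
        (\<Sum>j\<le>m. if k + m - M = j then - (of_nat (m choose j) * (- x) ^ j) else 0)"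
      by (intro sum.cong refl) (auto simp: algebra_simps)
    also have "\<dots> = (if k + m - M \<le> m then - (of_nat (m choose (k + m - M)) * (- x) ^ (k + m - M)) else 0)"
      by simp
    \<comment> \<open>If \<open>k > q - 1\<close>, the required index exceeds \<open>m\<close>; the
      binomial coefficient is then zero, so the same formula holds.\<close>
    finally show ?thesis using False by (auto simp: binomial_eq_0)
  qed
  finally show ?thesis by (simp only: M_def)
qed

section \<open>An alternating sum over permutations\<close>

text \<open>The Leibniz expansion of the Vandermonde determinant of \<open>y 0, \<dots>, y (l - 1)\<close>.\<close>

definition alt_sum :: "nat \<Rightarrow> (nat \<Rightarrow> 'a::comm_ring_1) \<Rightarrow> 'a" where
  "alt_sum l y = (\<Sum>\<sigma> | \<sigma> permutes {..<l}. of_int (sign \<sigma>) * (\<Prod>i<l. y i ^ \<sigma> i))"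

lemma alt_sum_cong:
  "(\<And>i. i < l \<Longrightarrow> y i = y' i) \<Longrightarrow> alt_sum l y = alt_sum l y'"
  by (simp add: alt_sum_def)

lemma alt_sum_mult_left: "alt_sum l (\<lambda>i. c * y i) = c ^ (\<Sum>i<l. i) * alt_sum l y"
proof -
  have "(\<Prod>i<l. (c * y i) ^ \<sigma> i) = c ^ (\<Sum>i<l. i) * (\<Prod>i<l. y i ^ \<sigma> i)"
    if "\<sigma> permutes {..<l}" for \<sigma>
  proof -
    have "(\<Sum>i<l. \<sigma> i) = (\<Sum>i<l. i)"
      using sum.permute[OF that, of "\<lambda>i. i"] by (simp add: o_def)
    then show ?thesis
      by (simp add: power_mult_distrib prod.distrib flip: power_sum)
  qed
  then show ?thesis
    by (simp add: alt_sum_def sum_distrib_left mult_ac)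
qed

text \<open>Composing with the transposition of \<open>a\<close> and \<open>b\<close> flips every
  sign and changes no product, so the sum is its own negative.\<close>

lemma alt_sum_eq_0:
  fixes y :: "nat \<Rightarrow> 'a::field"
  assumes "a < l" "b < l" "a \<noteq> b" "y a = y b" "(2 :: 'a) \<noteq> 0"
  shows "alt_sum l y = 0"
proof -
  let ?t = "transpose a b"
  have t: "?t permutes {..<l}" using assms by (intro permutes_swap_id) auto
  have yt: "y (?t i) = y i" for i using assms(4) by (auto simp: transpose_def)
  have "alt_sum l y = (\<Sum>\<sigma> | \<sigma> permutes {..<l}. of_int (sign (\<sigma> \<circ> ?t)) * (\<Prod>i<l. y i ^ (\<sigma> \<circ> ?t) i))"
    unfolding alt_sum_def by (rule sum_permutations_compose_right[OF t])
  also have "\<dots> = (\<Sum>\<sigma> | \<sigma> permutes {..<l}. - (of_int (sign \<sigma>) * (\<Prod>i<l. y i ^ \<sigma> i)))"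
  proof (intro sum.cong refl)
    fix \<sigma> assume "\<sigma> \<in> {\<sigma>. \<sigma> permutes {..<l}}"
    then have "permutation \<sigma>" by (auto intro: permutes_imp_permutation)
    then have "sign (\<sigma> \<circ> ?t) = - sign \<sigma>"
      using assms(3) by (simp add: sign_compose permutation_swap_id sign_swap_id)
    moreover have "(\<Prod>i<l. y i ^ (\<sigma> \<circ> ?t) i) = (\<Prod>i<l. y i ^ \<sigma> i)"
      using prod.permute[OF t, of "\<lambda>i. y i ^ \<sigma> i"] by (simp add: o_def yt)
    ultimately show "of_int (sign (\<sigma> \<circ> ?t)) * (\<Prod>i<l. y i ^ (\<sigma> \<circ> ?t) i) =
        - (of_int (sign \<sigma>) * (\<Prod>i<l. y i ^ \<sigma> i))" by simp
  qed
  also have "\<dots> = - alt_sum l y" by (simp add: alt_sum_def sum_negf)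
  finally have "2 * alt_sum l y = 0" by (simp add: eq_neg_iff_add_eq_0)
  then show ?thesis using assms(5) by simp
qed

text \<open>By symmetry the inner sum is the same with \<open>\<rho> i\<close> in place of
  \<open>\<rho> 0\<close>, and summing over all \<open>i\<close> first gives the constant
  \<open>\<Sum>a<l. h a\<close>. The factor \<open>l\<close> stays on the left because it need not
  be invertible.\<close>

lemma sum_permutes_apply:
  fixes h :: "nat \<Rightarrow> 'a::comm_ring_1"
  assumes "l > 0"
  shows "of_nat l * (\<Sum>\<rho> | \<rho> permutes {..<l}. h (\<rho> 0)) = of_nat (fact l) * (\<Sum>a<l. h a)"
proof -
  let ?P = "{\<rho>. \<rho> permutes {..<l}}"
  have eq: "(\<Sum>\<rho>\<in>?P. h (\<rho> i)) = (\<Sum>\<rho>\<in>?P. h (\<rho> 0))" if "i < l" for i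
  proof -
    have "transpose 0 i permutes {..<l}" using that by (intro permutes_swap_id) auto
    from sum_permutations_compose_right[OF this, of "\<lambda>\<rho>. h (\<rho> i)"] show ?thesis by simp
  qed
  have "of_nat l * (\<Sum>\<rho>\<in>?P. h (\<rho> 0)) = (\<Sum>i<l. \<Sum>\<rho>\<in>?P. h (\<rho> 0))"
    by simp
  also have "\<dots> = (\<Sum>i<l. \<Sum>\<rho>\<in>?P. h (\<rho> i))"
    by (intro sum.cong refl eq[symmetric]) simp
  also have "\<dots> = (\<Sum>\<rho>\<in>?P. \<Sum>i<l. h (\<rho> i))" by (rule sum.swap)
  also have "\<dots> = (\<Sum>\<rho>\<in>?P. \<Sum>a<l. h a)"
    by (intro sum.cong refl sum.permute[symmetric, unfolded o_def]) simp
  also have "\<dots> = of_nat (card ?P) * (\<Sum>a<l. h a)" by simp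
  also have "card ?P = fact l" by (rule card_permutations) auto
  finally show ?thesis by simp
qed

text \<open>The total displacement of two permutations is zero, so one unit of slack at index 0
  can only be compensated by a transposition.\<close>

lemma permutes_almost_le:
  assumes \<sigma>: "\<sigma> permutes {..<l}" and \<rho>: "\<rho> permutes {..<l}"
    and le: "\<And>i. 0 < i \<Longrightarrow> i < l \<Longrightarrow> \<rho> i \<le> \<sigma> i" and le0: "\<rho> 0 \<le> Suc (\<sigma> 0)"
  shows "\<sigma> = \<rho> \<or> (\<exists>j\<in>{0<..<l}. \<rho> 0 = Suc (\<rho> j) \<and> \<sigma> = \<rho> \<circ> transpose 0 j)"
proof (cases "l = 0")
  case True
  then show ?thesis using \<sigma> \<rho> by simp
next
  case False
  have sum: "(\<Sum>i<l. \<sigma> i) = (\<Sum>i<l. \<rho> i)"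
    using sum.permute[OF \<sigma>, of "\<lambda>i. i"] sum.permute[OF \<rho>, of "\<lambda>i. i"] by (simp add: o_def)
  have out: "\<sigma> i = i" "\<rho> i = i" if "\<not> i < l" for i
    using that permutes_not_in[OF \<sigma>] permutes_not_in[OF \<rho>] by auto
  have split: "{..<l} = insert 0 {0<..<l}" using False by auto
  show ?thesis
  proof (cases "\<rho> 0 \<le> \<sigma> 0")
    case True
    then have all: "\<rho> i \<le> \<sigma> i" if "i < l" for i using le that by (cases "i = 0") auto
    have "\<rho> i = \<sigma> i" if "i < l" for i
      using sum_mono_inv[of \<rho> "{..<l}" \<sigma> i] sum all that by auto
    then have "\<rho> i = \<sigma> i" for i using out by (cases "i < l") auto
    then show ?thesis by auto
  next
    case False
    then have s0: "\<rho> 0 = Suc (\<sigma> 0)" using le0 by simp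
    have sum1: "(\<Sum>i\<in>{0<..<l}. \<sigma> i) = Suc (\<Sum>i\<in>{0<..<l}. \<rho> i)"
      using sum s0 unfolding split by simp
    have "\<exists>j\<in>{0<..<l}. \<rho> j < \<sigma> j"
    proof (rule ccontr)
      assume "\<not> ?thesis"
      then have "(\<Sum>i\<in>{0<..<l}. \<sigma> i) \<le> (\<Sum>i\<in>{0<..<l}. \<rho> i)" by (intro sum_mono) (simp add: not_less)
      then show False using sum1 by simp
    qed
    then obtain j where j: "j \<in> {0<..<l}" "\<rho> j < \<sigma> j" by blast
    \<comment> \<open>The index \<open>j\<close> uses up the whole surplus of one unit, so
      \<open>\<sigma>\<close> and \<open>\<rho>\<close> agree at all indices other than 0 and
      \<open>j\<close>.\<close>
    let ?R = "{0<..<l} - {j}"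
    have "(\<Sum>i\<in>?R. \<rho> i) \<le> (\<Sum>i\<in>?R. \<sigma> i)" using le by (intro sum_mono) auto
    moreover have "\<sigma> j + (\<Sum>i\<in>?R. \<sigma> i) = Suc (\<rho> j + (\<Sum>i\<in>?R. \<rho> i))"
      using sum1 j by (simp add: sum.remove)
    ultimately have sumR: "(\<Sum>i\<in>?R. \<rho> i) = (\<Sum>i\<in>?R. \<sigma> i)" using j by linarith
    have eq: "\<sigma> i = \<rho> i" if "i \<noteq> 0" "i \<noteq> j" for i
    proof (cases "i < l")
      case True
      then show ?thesis using sum_mono_inv[OF sumR, of i] le that by auto
    qed (use out in auto)
    \<comment> \<open>Injectivity now forces \<open>\<sigma>\<close> to exchange the two remaining
      values of \<open>\<rho>\<close>.\<close>
    obtain k where k: "\<sigma> 0 = \<rho> k" using permutes_surj[OF \<rho>] by (metis surjD)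
    have "k = j"
    proof (rule ccontr)
      assume "k \<noteq> j"
      moreover have "k \<noteq> 0" using k s0 by (metis n_not_Suc_n)
      ultimately have "\<sigma> k = \<sigma> 0" using eq k by simp
      then show False using \<open>k \<noteq> 0\<close> permutes_inj[OF \<sigma>] by (auto dest: injD)
    qed
    obtain k' where k': "\<sigma> j = \<rho> k'" using permutes_surj[OF \<rho>] by (metis surjD)
    have "k' = 0"
    proof (rule ccontr)
      assume "k' \<noteq> 0"
      moreover have "k' \<noteq> j" using k' j by (metis less_irrefl)
      ultimately have "\<sigma> k' = \<sigma> j" using eq k' by simp
      then show False using \<open>k' \<noteq> j\<close> permutes_inj[OF \<sigma>] by (auto dest: injD)
    qed
    have "\<sigma> = \<rho> \<circ> transpose 0 j"
      using eq k k' \<open>k = j\<close> \<open>k' = 0\<close> by (auto simp: fun_eq_iff transpose_def)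
    then show ?thesis using j k s0 \<open>k = j\<close> by auto
  qed
qed

section \<open>A signed count of odd orthomorphisms and its moments\<close>

lemma six_times_sum_choose_2:
  "6 * (\<Sum>k<l. (2 * k + 1) choose 2) + l * (4 * l + 1) = l * l * (4 * l + 1)"
proof (induction l)
  case (Suc l)
  have "(2 * l + 1) choose 2 = l * (2 * l + 1)" by (simp add: choose_two)
  then show ?case using Suc by (simp add: algebra_simps)
qed simp

text \<open>In the application \<open>x\<close> lists one element of each pair
  \<open>y, - y\<close>, and \<open>f i\<close> is the value of an odd map at \<open>x i\<close>.
  The product removes maps for which \<open>f i\<close> or \<open>f i - x i\<close> is zero, and the
  alternating sums remove repeated squares; so only odd orthomorphisms contribute. The weight
  \<open>f 0 ^ e\<close> gives several counts that can be compared.\<close>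

definition weighted_sum :: "nat \<Rightarrow> (nat \<Rightarrow> 'a::finite_field) \<Rightarrow> nat \<Rightarrow> 'a" where
  "weighted_sum l x e = (\<Sum>f\<in>PiE {..<l} (\<lambda>_. UNIV).
     f 0 ^ e * (\<Prod>i<l. f i * (f i - x i)) *
     alt_sum l (\<lambda>i. f i ^ 2) * alt_sum l (\<lambda>i. (f i - x i) ^ 2))"

text \<open>The second exponent is indexed by \<open>l - 1 - r\<close>, so that a moment vanishes for \<open>s < r\<close>
  (shifted by one for \<open>i = 0\<close> and \<open>e = 2\<close>) and the permutations are compared directly.\<close>

definition moment :: "nat \<Rightarrow> (nat \<Rightarrow> 'a::finite_field) \<Rightarrow> nat \<Rightarrow> nat \<Rightarrow> nat \<Rightarrow> nat \<Rightarrow> 'a" where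
  "moment l x e i s r = (\<Sum>u\<in>UNIV. u ^ (2 * s + 1 + (if i = 0 then e else 0)) * (u - x i) ^ (2 * (l - 1 - r) + 1))"

text \<open>Expanding both alternating sums turns the sum over \<open>f\<close> into a product of
  sums over single values. The constant \<open>\<kappa>\<close> does not depend on \<open>e\<close>,
  so it drops out when two weighted sums are compared.\<close>

lemma weighted_sum_eq_moments:
  fixes x :: "nat \<Rightarrow> 'a::finite_field"
  assumes "l > 0"
  obtains \<kappa> :: 'a where "\<kappa> \<noteq> 0"
    "\<And>e. weighted_sum l x e = \<kappa> * (\<Sum>\<rho> | \<rho> permutes {..<l}. \<Sum>\<sigma> | \<sigma> permutes {..<l}.
       of_int (sign \<sigma>) * of_int (sign \<rho>) * (\<Prod>i<l. moment l x e i (\<sigma> i) (\<rho> i)))"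
proof -
  let ?P = "{\<sigma>. \<sigma> permutes {..<l}}"
  \<comment> \<open>The reversal of the exponents in the second alternating sum; its sign is
    \<open>\<kappa>\<close>.\<close>
  define rv where "rv i = (if i < l then l - 1 - i else i)" for i
  have rv: "rv permutes {..<l}"
  proof (rule bij_imp_permutes)
    show "bij_betw rv {..<l} {..<l}"
      by (rule bij_betw_byWitness[where f' = rv]) (auto simp: rv_def)
  qed (auto simp: rv_def)
  define \<kappa> :: 'a where "\<kappa> = of_int (sign rv)"
  have "\<kappa> \<noteq> 0" by (simp add: \<kappa>_def sign_def)
  moreover have "weighted_sum l x e = \<kappa> * (\<Sum>\<rho>\<in>?P. \<Sum>\<sigma>\<in>?P.
       of_int (sign \<sigma>) * of_int (sign \<rho>) * (\<Prod>i<l. moment l x e i (\<sigma> i) (\<rho> i)))" for e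
  proof -
    define w where "w i u = (if i = 0 then u ^ e else 1) * (u * (u - x i))" for i u
    have w: "f 0 ^ e * (\<Prod>i<l. f i * (f i - x i)) = (\<Prod>i<l. w i (f i))" for f
    proof -
      have "f 0 ^ e = (\<Prod>i<l. if i = 0 then f i ^ e else 1)"
        using assms by simp
      also have "\<dots> * (\<Prod>i<l. f i * (f i - x i)) = (\<Prod>i<l. w i (f i))"
        unfolding prod.distrib[symmetric] w_def by (rule prod.cong) simp_all
      finally show ?thesis .
    qed
    have "weighted_sum l x e = (\<Sum>f\<in>PiE {..<l} (\<lambda>_. UNIV). \<Sum>\<tau>\<in>?P. \<Sum>\<sigma>\<in>?P.
        of_int (sign \<sigma>) * of_int (sign \<tau>) * (\<Prod>i<l. w i (f i) * (f i ^ 2) ^ \<sigma> i * ((f i - x i) ^ 2) ^ \<tau> i))"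
      unfolding weighted_sum_def w alt_sum_def sum_distrib_left sum_distrib_right
      by (intro sum.cong refl) (simp only: prod.distrib mult_ac)
    also have "\<dots> = (\<Sum>\<tau>\<in>?P. \<Sum>\<sigma>\<in>?P. \<Sum>f\<in>PiE {..<l} (\<lambda>_. UNIV).
        of_int (sign \<sigma>) * of_int (sign \<tau>) * (\<Prod>i<l. w i (f i) * (f i ^ 2) ^ \<sigma> i * ((f i - x i) ^ 2) ^ \<tau> i))"
      by (subst sum.swap, intro sum.cong refl, rule sum.swap)
    also have "\<dots> = (\<Sum>\<tau>\<in>?P. \<Sum>\<sigma>\<in>?P. of_int (sign \<sigma>) * of_int (sign \<tau>) *
        (\<Prod>i<l. \<Sum>u\<in>UNIV. w i u * (u ^ 2) ^ \<sigma> i * ((u - x i) ^ 2) ^ \<tau> i))"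
      by (simp add: prod_sum_PiE sum_distrib_left)
    also have "\<dots> = (\<Sum>\<rho>\<in>?P. \<Sum>\<sigma>\<in>?P. of_int (sign \<sigma>) * of_int (sign (rv \<circ> \<rho>)) *
        (\<Prod>i<l. \<Sum>u\<in>UNIV. w i u * (u ^ 2) ^ \<sigma> i * ((u - x i) ^ 2) ^ (rv \<circ> \<rho>) i))"
      by (rule setum_permutations_compose_left[OF rv])
    also have "\<dots> = (\<Sum>\<rho>\<in>?P. \<Sum>\<sigma>\<in>?P. \<kappa> * (of_int (sign \<sigma>) * of_int (sign \<rho>) *
        (\<Prod>i<l. moment l x e i (\<sigma> i) (\<rho> i))))"
    proof (intro sum.cong refl)
      fix \<rho> \<sigma> assume "\<rho> \<in> ?P" "\<sigma> \<in> ?P"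
      then have \<rho>: "\<rho> permutes {..<l}" by simp
      have "sign (rv \<circ> \<rho>) = sign rv * sign \<rho>"
        using \<rho> rv by (intro sign_compose) (auto intro: permutes_imp_permutation)
      moreover have "(\<Sum>u\<in>UNIV. w i u * (u ^ 2) ^ \<sigma> i * ((u - x i) ^ 2) ^ (rv \<circ> \<rho>) i) =
          moment l x e i (\<sigma> i) (\<rho> i)" if "i < l" for i
      proof -
        have "\<rho> i < l" using permutes_in_image[OF \<rho>, of i] that by simp
        then have rv_eq: "(rv \<circ> \<rho>) i = l - 1 - \<rho> i" by (simp add: rv_def)
        have "w i u * (u ^ 2) ^ s * ((u - x i) ^ 2) ^ r =
          u ^ (2 * s + 1 + (if i = 0 then e else 0)) * (u - x i) ^ (2 * r + 1)" for u s r
          by (simp add: w_def power_add power_mult power_mult_distrib mult_ac flip: power_mult)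
        then show ?thesis unfolding moment_def rv_eq by simp
      qed
      ultimately show "of_int (sign \<sigma>) * of_int (sign (rv \<circ> \<rho>)) *
          (\<Prod>i<l. \<Sum>u\<in>UNIV. w i u * (u ^ 2) ^ \<sigma> i * ((u - x i) ^ 2) ^ (rv \<circ> \<rho>) i) =
          \<kappa> * (of_int (sign \<sigma>) * of_int (sign \<rho>) * (\<Prod>i<l. moment l x e i (\<sigma> i) (\<rho> i)))"
        by (simp add: \<kappa>_def mult_ac)
    qed
    finally show ?thesis by (simp add: sum_distrib_left)
  qed
  ultimately show thesis by (rule that)
qed

text \<open>The two exponents add up to \<open>2 * l + 2 * (s - r)\<close>, where
  \<open>2 * l = q - 1\<close>. So the three cases pick no binomial coefficient, the zeroth and the
  second one. The assumption on \<open>e\<close> says that there is no extra weight at this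
  index.\<close>

lemma moment_eq:
  fixes g :: "'a::finite_field" and x :: "nat \<Rightarrow> 'a"
  assumes g: "generates_units g" and card: "CARD('a) - 1 = 2 * l" and s: "s < l" and r: "r < l"
    and e: "i = 0 \<Longrightarrow> e = 0"
  shows "s < r \<Longrightarrow> moment l x e i s r = 0"
    and "s = r \<Longrightarrow> moment l x e i s r = -1"
    and "s = Suc r \<Longrightarrow> moment l x e i s r = - (of_nat ((2 * (l - 1 - r) + 1) choose 2) * x i ^ 2)"
proof -
  have "(if i = 0 then e else 0) = 0" using e by simp
  then have m: "moment l x e i s r = (\<Sum>u\<in>UNIV. u ^ (2 * s + 1) * (u - x i) ^ (2 * (l - 1 - r) + 1))"
    by (simp add: moment_def)
  have lt: "2 * s + 1 + (2 * (l - 1 - r) + 1) < 2 * (CARD('a) - 1)"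
    using s r unfolding card by simp
  have "(\<Sum>u\<in>UNIV. u ^ (2 * s + 1) * (u - x i) ^ (2 * (l - 1 - r) + 1)) =
    (let n = 2 * s + 1 + (2 * (l - 1 - r) + 1) in if n < 2 * l then 0
     else - (of_nat ((2 * (l - 1 - r) + 1) choose (n - 2 * l)) * (- x i) ^ (n - 2 * l)))"
    unfolding Let_def card[symmetric] by (rule sum_power_times_power_diff_UNIV[OF g lt])
  note eq = m[unfolded this]
  {
    assume "s < r"
    then have "2 * s + 1 + (2 * (l - 1 - r) + 1) < 2 * l" using r by simp
    then show "moment l x e i s r = 0" using eq by (simp add: Let_def)
  next
    assume "s = r"
    then have "2 * s + 1 + (2 * (l - 1 - r) + 1) = 2 * l" using r by simp
    then show "moment l x e i s r = -1" using eq by (simp add: Let_def)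
  next
    assume "s = Suc r"
    then have "2 * s + 1 + (2 * (l - 1 - r) + 1) = 2 * l + 2" using r by simp
    then show "moment l x e i s r = - (of_nat ((2 * (l - 1 - r) + 1) choose 2) * x i ^ 2)"
      using eq by (simp add: Let_def)
  }
qed

text \<open>The extra weight \<open>u ^ 2\<close> acts like raising \<open>s\<close> by one, so each
  case of the previous lemma moves by one.\<close>

lemma moment_0_2_eq:
  fixes g :: "'a::finite_field" and x :: "nat \<Rightarrow> 'a"
  assumes g: "generates_units g" and card: "CARD('a) - 1 = 2 * l" and r: "r < l" and l: "l \<ge> 2"
  shows "Suc s < r \<Longrightarrow> moment l x 2 0 s r = 0"
    and "Suc s = r \<Longrightarrow> moment l x 2 0 s r = -1"
    and "s = r \<Longrightarrow> moment l x 2 0 s r = - (of_nat ((2 * (l - 1 - r) + 1) choose 2) * x 0 ^ 2)"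
proof -
  have m: "moment l x 2 0 s r = (\<Sum>u\<in>UNIV. u ^ (2 * s + 3) * (u - x 0) ^ (2 * (l - 1 - r) + 1))"
    by (simp add: moment_def eval_nat_numeral)
  \<comment> \<open>At \<open>s = r\<close> the total exponent is \<open>2 * l + 2\<close>, which is
    below \<open>4 * l\<close> because \<open>l \<ge> 2\<close>.\<close>
  have lt: "2 * s + 3 + (2 * (l - 1 - r) + 1) < 2 * (CARD('a) - 1)" if "s \<le> r"
    using that r l unfolding card by simp
  have eq: "moment l x 2 0 s r =
    (let n = 2 * s + 3 + (2 * (l - 1 - r) + 1) in if n < 2 * l then 0
     else - (of_nat ((2 * (l - 1 - r) + 1) choose (n - 2 * l)) * (- x 0) ^ (n - 2 * l)))" if "s \<le> r"
    unfolding m Let_def card[symmetric] by (rule sum_power_times_power_diff_UNIV[OF g lt[OF that]])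
  {
    assume "Suc s < r"
    then have "2 * s + 3 + (2 * (l - 1 - r) + 1) < 2 * l" "s \<le> r" using r by simp_all
    then show "moment l x 2 0 s r = 0" using eq by (simp add: Let_def)
  next
    assume "Suc s = r"
    then have "2 * s + 3 + (2 * (l - 1 - r) + 1) = 2 * l" "s \<le> r" using r by auto
    then show "moment l x 2 0 s r = -1" using eq by (simp add: Let_def)
  next
    assume "s = r"
    then have n: "2 * s + 3 + (2 * (l - 1 - r) + 1) = 2 * l + 2" and "s \<le> r" using r by simp_all
    from eq[OF \<open>s \<le> r\<close>, unfolded Let_def n] show "moment l x 2 0 s r = - (of_nat ((2 * (l - 1 - r) + 1) choose 2) * x 0 ^ 2)"
      by simp
  }
qed

lemma prod_eq_neg_one_power:
  assumes "finite A" "\<And>i. i \<in> A \<Longrightarrow> h i = (-1 :: 'a::comm_ring_1)"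
  shows "prod h A = (-1) ^ card A"
  using assms(2) by simp

text \<open>A product of moments vanishes once some \<open>\<sigma> i < \<rho> i\<close>. As both
  permutations have the same total, only \<open>\<sigma> = \<rho>\<close> survives, and each of the
  \<open>fact l\<close> diagonal terms is \<open>(-1) ^ l\<close>.\<close>

lemma weighted_sum_0:
  fixes g :: "'a::finite_field" and x :: "nat \<Rightarrow> 'a"
  assumes g: "generates_units g" and card: "CARD('a) - 1 = 2 * l"
    and \<kappa>: "weighted_sum l x 0 = \<kappa> * (\<Sum>\<rho> | \<rho> permutes {..<l}. \<Sum>\<sigma> | \<sigma> permutes {..<l}.
       of_int (sign \<sigma>) * of_int (sign \<rho>) * (\<Prod>i<l. moment l x 0 i (\<sigma> i) (\<rho> i)))"
  shows "weighted_sum l x 0 = \<kappa> * ((-1) ^ l * (of_nat (fact l) :: 'a))"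
proof -
  let ?P = "{\<sigma>. \<sigma> permutes {..<l}}"
  have fin: "finite ?P" by (simp add: finite_permutations)
  have "(\<Sum>\<sigma>\<in>?P. of_int (sign \<sigma>) * of_int (sign \<rho>) * (\<Prod>i<l. moment l x 0 i (\<sigma> i) (\<rho> i))) = (-1) ^ l"
    if \<rho>: "\<rho> \<in> ?P" for \<rho>
  proof -
    have \<rho>l: "\<rho> i < l" if "i < l" for i using permutes_in_image[of \<rho> "{..<l}" i] \<rho> that by simp
    have "(\<Sum>\<sigma>\<in>?P. of_int (sign \<sigma>) * of_int (sign \<rho>) * (\<Prod>i<l. moment l x 0 i (\<sigma> i) (\<rho> i))) =
        (\<Sum>\<sigma>\<in>{\<rho>}. of_int (sign \<sigma>) * of_int (sign \<rho>) * (\<Prod>i<l. moment l x 0 i (\<sigma> i) (\<rho> i)))"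
    proof (rule sum.mono_neutral_right)
      show "\<forall>\<sigma>\<in>?P - {\<rho>}. of_int (sign \<sigma>) * of_int (sign \<rho>) * (\<Prod>i<l. moment l x 0 i (\<sigma> i) (\<rho> i)) = 0"
      proof
        fix \<sigma> assume \<sigma>: "\<sigma> \<in> ?P - {\<rho>}"
        then have \<sigma>l: "\<sigma> i < l" if "i < l" for i using permutes_in_image[of \<sigma> "{..<l}" i] that by simp
        have "\<exists>i<l. \<sigma> i < \<rho> i"
        proof (rule ccontr)
          assume "\<not> ?thesis"
          then have le: "\<rho> i \<le> \<sigma> i" if "i < l" for i using that by (meson not_less)
          have "\<rho> 0 \<le> Suc (\<sigma> 0)"
            using le[of 0] permutes_not_in[of \<sigma> "{..<l}" 0] permutes_not_in[of \<rho> "{..<l}" 0] \<sigma> \<rho>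
            by (cases "0 < l") auto
          \<comment> \<open>The transposition would give \<open>\<sigma> 0 < \<rho> 0\<close>, which
            is excluded when there is no extra weight.\<close>
          then have "\<exists>j\<in>{0<..<l}. \<rho> 0 = Suc (\<rho> j) \<and> \<sigma> = \<rho> \<circ> transpose 0 j"
            using permutes_almost_le[of \<sigma> l \<rho>] \<sigma> \<rho> le by auto
          then obtain j where "j \<in> {0<..<l}" "\<rho> 0 = Suc (\<rho> j)" "\<sigma> 0 = \<rho> j" by auto
          then show False using le[of 0] by simp
        qed
        then obtain i where "i < l" "\<sigma> i < \<rho> i" by blast
        then have "moment l x 0 i (\<sigma> i) (\<rho> i) = 0"
          by (intro moment_eq(1)[OF g card]) (auto simp: \<sigma>l \<rho>l)
        then have "(\<Prod>i<l. moment l x 0 i (\<sigma> i) (\<rho> i)) = 0"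
          using \<open>i < l\<close> by (intro prod_zero) auto
        then show "of_int (sign \<sigma>) * of_int (sign \<rho>) * (\<Prod>i<l. moment l x 0 i (\<sigma> i) (\<rho> i)) = 0" by simp
      qed
    qed (use fin \<rho> in auto)
    also have "\<dots> = (\<Prod>i<l. moment l x 0 i (\<rho> i) (\<rho> i))"
      by (simp flip: of_int_mult)
    also have "\<dots> = (-1) ^ card {..<l}"
      by (intro prod_eq_neg_one_power moment_eq(2)[OF g card]) (auto simp: \<rho>l)
    finally show ?thesis by simp
  qed
  then show ?thesis using card_permutations[of "{..<l}" l]
    by (simp add: \<kappa> mult_ac)
qed

text \<open>The weight allows \<open>\<sigma> 0\<close> to be one less than \<open>\<rho> 0\<close>.
  By \<open>permutes_almost_le\<close> this leaves \<open>\<sigma> = \<rho>\<close>, giving the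
  first sum, and certain transpositions of it, giving the second sum with the opposite sign.\<close>

lemma weighted_sum_2:
  fixes g :: "'a::finite_field" and x :: "nat \<Rightarrow> 'a" and l :: nat
  defines "B \<equiv> (\<lambda>r. of_nat ((2 * (l - 1 - r) + 1) choose 2) :: 'a)"
  assumes g: "generates_units g" and card: "CARD('a) - 1 = 2 * l" and l: "l \<ge> 2"
    and \<kappa>: "weighted_sum l x 2 = \<kappa> * (\<Sum>\<rho> | \<rho> permutes {..<l}. \<Sum>\<sigma> | \<sigma> permutes {..<l}.
       of_int (sign \<sigma>) * of_int (sign \<rho>) * (\<Prod>i<l. moment l x 2 i (\<sigma> i) (\<rho> i)))"
  shows "weighted_sum l x 2 = \<kappa> * ((-1) ^ l *
    (x 0 ^ 2 * (\<Sum>\<rho> | \<rho> permutes {..<l}. B (\<rho> 0)) -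
     (\<Sum>\<rho> | \<rho> permutes {..<l}. \<Sum>j\<in>{0<..<l}. if \<rho> 0 = Suc (\<rho> j) then B (\<rho> j) * x j ^ 2 else 0)))"
proof -
  let ?P = "{\<sigma>. \<sigma> permutes {..<l}}"
  have fin: "finite ?P" by (simp add: finite_permutations)
  have "(\<Sum>\<sigma>\<in>?P. of_int (sign \<sigma>) * of_int (sign \<rho>) * (\<Prod>i<l. moment l x 2 i (\<sigma> i) (\<rho> i))) =
      (-1) ^ l * (x 0 ^ 2 * B (\<rho> 0) - (\<Sum>j\<in>{0<..<l}. if \<rho> 0 = Suc (\<rho> j) then B (\<rho> j) * x j ^ 2 else 0))"
    if \<rho>P: "\<rho> \<in> ?P" for \<rho>
  proof -
    have \<rho>: "\<rho> permutes {..<l}" using \<rho>P by simp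
    have \<rho>l: "\<rho> i < l" if "i < l" for i using permutes_in_image[OF \<rho>, of i] that by simp
    let ?F = "\<lambda>\<sigma>. of_int (sign \<sigma>) * of_int (sign \<rho>) * (\<Prod>i<l. moment l x 2 i (\<sigma> i) (\<rho> i))"
    \<comment> \<open>This set has at most one element, as \<open>\<rho>\<close> is injective;
      summing over it avoids a case distinction.\<close>
    let ?J = "{j \<in> {0<..<l}. \<rho> 0 = Suc (\<rho> j)}"
    let ?h = "\<lambda>j. \<rho> \<circ> transpose 0 j"
    have hP: "?h j \<in> ?P" if "j \<in> ?J" for j
      using that l permutes_compose[OF permutes_swap_id[of 0 "{..<l}" j] \<rho>] by auto
    have inj: "inj_on ?h ?J"
    proof (rule inj_onI)
      fix j k assume "?h j = ?h k"
      then have "?h j 0 = ?h k 0" by simp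
      then show "j = k" using permutes_inj[OF \<rho>] by (simp add: inj_eq)
    qed
    have notin: "\<rho> \<notin> ?h ` ?J"
    proof
      assume "\<rho> \<in> ?h ` ?J"
      then obtain j where j: "j \<in> ?J" and eq: "\<rho> = ?h j" by blast
      have "\<rho> 0 = ?h j 0" by (rule fun_cong[OF eq])
      then have "\<rho> 0 = \<rho> j" unfolding o_apply transpose_apply_first .
      then show False using j by simp
    qed
    have zero: "?F \<sigma> = 0" if \<sigma>: "\<sigma> \<in> ?P - insert \<rho> (?h ` ?J)" for \<sigma>
    proof -
      have \<sigma>P: "\<sigma> permutes {..<l}" using \<sigma> by simp
      have \<sigma>l: "\<sigma> i < l" if "i < l" for i using permutes_in_image[OF \<sigma>P, of i] that by simp
      have "\<not> (\<sigma> = \<rho> \<or> (\<exists>j\<in>{0<..<l}. \<rho> 0 = Suc (\<rho> j) \<and> \<sigma> = \<rho> \<circ> transpose 0 j))"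
        using \<sigma> by blast
      then have "(\<exists>i. 0 < i \<and> i < l \<and> \<sigma> i < \<rho> i) \<or> Suc (\<sigma> 0) < \<rho> 0"
        using permutes_almost_le[OF \<sigma>P \<rho>] by (meson not_less)
      then have "\<exists>i<l. moment l x 2 i (\<sigma> i) (\<rho> i) = 0"
      proof
        assume "\<exists>i. 0 < i \<and> i < l \<and> \<sigma> i < \<rho> i"
        then obtain i where i: "0 < i" "i < l" "\<sigma> i < \<rho> i" by blast
        then have "moment l x 2 i (\<sigma> i) (\<rho> i) = 0"
          by (intro moment_eq(1)[OF g card]) (auto simp: \<sigma>l \<rho>l)
        then show ?thesis using i by blast
      next
        assume "Suc (\<sigma> 0) < \<rho> 0"
        then have "moment l x 2 0 (\<sigma> 0) (\<rho> 0) = 0"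
          by (intro moment_0_2_eq(1)[OF g card _ l]) (use \<rho>l l in auto)
        then show ?thesis using l by (intro exI[of _ 0]) simp
      qed
      then have "(\<Prod>i<l. moment l x 2 i (\<sigma> i) (\<rho> i)) = 0"
        by (intro prod_zero) auto
      then show ?thesis by simp
    qed
    have l0: "{..<l} = insert 0 {0<..<l}" using l by auto
    obtain k where k: "l = Suc (Suc k)" using l by (auto simp: numeral_2_eq_2 le_iff_add)
    have pow1: "(-1 :: 'a) ^ l = - ((-1) ^ (l - 1))" and pow2: "(-1 :: 'a) ^ l = (-1) ^ (l - 2)"
      by (simp_all add: k)
    have F\<rho>: "?F \<rho> = (-1) ^ l * (x 0 ^ 2 * B (\<rho> 0))"
    proof -
      have "?F \<rho> = (\<Prod>i<l. moment l x 2 i (\<rho> i) (\<rho> i))" by (simp flip: of_int_mult)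
      also have "\<dots> = moment l x 2 0 (\<rho> 0) (\<rho> 0) * (\<Prod>i\<in>{0<..<l}. moment l x 2 i (\<rho> i) (\<rho> i))"
        unfolding l0 by simp
      also have "(\<Prod>i\<in>{0<..<l}. moment l x 2 i (\<rho> i) (\<rho> i)) = (-1) ^ card {0<..<l}"
        by (intro prod_eq_neg_one_power moment_eq(2)[OF g card]) (auto simp: \<rho>l)
      also have "moment l x 2 0 (\<rho> 0) (\<rho> 0) = - (B (\<rho> 0) * x 0 ^ 2)"
        unfolding B_def by (rule moment_0_2_eq(3)[OF g card _ l]) (use \<rho>l l in auto)
      also have "card {0<..<l} = l - 1" by simp
      finally show ?thesis by (simp only: pow1) (simp add: mult_ac)
    qed
    have Fh: "?F (?h j) = - ((-1) ^ l * (B (\<rho> j) * x j ^ 2))" if j: "j \<in> ?J" for j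
    proof -
      have "j < l" "0 < j" "\<rho> 0 = Suc (\<rho> j)" using j by auto
      have "sign (?h j) = - sign \<rho>"
        using \<rho> \<open>0 < j\<close> by (simp add: sign_compose permutes_imp_permutation[of "{..<l}"] permutation_swap_id sign_swap_id)
      then have F: "?F (?h j) = - (\<Prod>i<l. moment l x 2 i (?h j i) (\<rho> i))"
        by (simp flip: of_int_mult)
      have "(\<Prod>i<l. moment l x 2 i (?h j i) (\<rho> i)) =
          moment l x 2 0 (\<rho> j) (\<rho> 0) * (moment l x 2 j (\<rho> 0) (\<rho> j) *
          (\<Prod>i\<in>{0<..<l} - {j}. moment l x 2 i (?h j i) (\<rho> i)))"
        unfolding l0 using \<open>j < l\<close> \<open>0 < j\<close> by (simp add: prod.remove[of "{0<..<l}" j])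
      also have "(\<Prod>i\<in>{0<..<l} - {j}. moment l x 2 i (?h j i) (\<rho> i)) = (-1) ^ card ({0<..<l} - {j})"
        by (intro prod_eq_neg_one_power moment_eq(2)[OF g card]) (auto simp: \<rho>l transpose_def)
      also have "card ({0<..<l} - {j}) = l - 2"
        using \<open>j < l\<close> \<open>0 < j\<close> by simp
      also have "moment l x 2 0 (\<rho> j) (\<rho> 0) = -1"
        by (rule moment_0_2_eq(2)[OF g card _ l]) (use \<rho>l[of 0] l \<open>\<rho> 0 = _\<close> in auto)
      also have "moment l x 2 j (\<rho> 0) (\<rho> j) = - (B (\<rho> j) * x j ^ 2)"
        unfolding B_def
        by (rule moment_eq(3)[OF g card]) (use \<rho>l[of 0] \<rho>l[of j] l \<open>j < l\<close> \<open>0 < j\<close> \<open>\<rho> 0 = _\<close> in auto)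
      finally show ?thesis unfolding F pow2 by simp
    qed
    have "(\<Sum>\<sigma>\<in>?P. ?F \<sigma>) = (\<Sum>\<sigma>\<in>insert \<rho> (?h ` ?J). ?F \<sigma>)"
      by (rule sum.mono_neutral_right) (use fin \<rho>P hP zero in auto)
    also have "\<dots> = ?F \<rho> + (\<Sum>\<sigma>\<in>?h ` ?J. ?F \<sigma>)"
      by (rule sum.insert) (use notin in auto)
    also have "(\<Sum>\<sigma>\<in>?h ` ?J. ?F \<sigma>) = (\<Sum>j\<in>?J. ?F (?h j))"
      by (simp only: sum.reindex[OF inj] o_def[of ?F])
    also have "\<dots> = (\<Sum>j\<in>?J. - ((-1) ^ l * (B (\<rho> j) * x j ^ 2)))"
      by (intro sum.cong refl Fh)
    also have "\<dots> = - ((-1) ^ l * (\<Sum>j\<in>{0<..<l}. if \<rho> 0 = Suc (\<rho> j) then B (\<rho> j) * x j ^ 2 else 0))"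
      by (simp add: sum_negf sum_distrib_left[symmetric] sum.inter_filter[symmetric])
    finally show ?thesis unfolding F\<rho> by (simp add: right_diff_distrib)
  qed
  then show ?thesis
    unfolding \<kappa> by (simp add: sum_subtractf sum_distrib_left[symmetric])
qed

text \<open>By symmetry the coefficient of \<open>x j ^ 2\<close> in \<open>weighted_sum_2\<close>
  is the same for all \<open>j > 0\<close>. As the squares sum to zero, these terms combine to a
  multiple of \<open>x 0 ^ 2\<close>, and the ratio becomes an explicit polynomial in
  \<open>l\<close>.\<close>

lemma weighted_sum_ratio:
  fixes g :: "'a::finite_field" and x :: "nat \<Rightarrow> 'a" and l :: nat
  assumes g: "generates_units g" and card: "CARD('a) - 1 = 2 * l" and l: "l \<ge> 2"
    and sq: "(\<Sum>i<l. x i ^ 2) = 0"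
    and nz: "of_nat l \<noteq> (0 :: 'a)" "of_nat (l - 1) \<noteq> (0 :: 'a)" "of_nat (fact l) \<noteq> (0 :: 'a)"
  shows "weighted_sum l x 0 \<noteq> 0"
    and "6 * weighted_sum l x 2 = x 0 ^ 2 * (of_nat l * (4 * of_nat l + 1)) * weighted_sum l x 0"
proof -
  let ?P = "{\<sigma>. \<sigma> permutes {..<l}}"
  obtain \<kappa> :: 'a where "\<kappa> \<noteq> 0" and \<kappa>: "\<And>e. weighted_sum l x e = \<kappa> * (\<Sum>\<rho> | \<rho> permutes {..<l}. \<Sum>\<sigma> | \<sigma> permutes {..<l}.
       of_int (sign \<sigma>) * of_int (sign \<rho>) * (\<Prod>i<l. moment l x e i (\<sigma> i) (\<rho> i)))"
    using weighted_sum_eq_moments[of l x] l by auto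
  note W0 = weighted_sum_0[OF g card \<kappa>]
  note W2 = weighted_sum_2[OF g card l \<kappa>]
  show "weighted_sum l x 0 \<noteq> 0" using \<open>\<kappa> \<noteq> 0\<close> nz by (simp add: W0)
  define B :: "nat \<Rightarrow> 'a" where "B r = of_nat ((2 * (l - 1 - r) + 1) choose 2)" for r
  define N where "N j = (\<Sum>\<rho>\<in>?P. if \<rho> 0 = Suc (\<rho> j) then B (\<rho> j) else 0)" for j
  \<comment> \<open>The value of \<open>B (\<rho> j)\<close> when \<open>\<rho> 0 = a\<close> is the
    successor of \<open>\<rho> j\<close>; for \<open>a = 0\<close> there is no such
    \<open>j\<close>, hence the default 0.\<close>
  define h where "h a = (if a = 0 then 0 else B (a - 1))" for a
  define S where "S = (\<Sum>a<l. B a)"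
  have split: "{..<l} = insert 0 {0<..<l}" using l by auto
  have N: "N j = N 1" if "j \<in> {0<..<l}" for j
  proof -
    have t: "transpose 1 j permutes {..<l}" using that l by (intro permutes_swap_id) auto
    have "(\<rho> \<circ> transpose 1 j) 0 = \<rho> 0" "(\<rho> \<circ> transpose 1 j) j = \<rho> 1" for \<rho> :: "nat \<Rightarrow> nat"
      using that by (auto simp: transpose_def)
    then show ?thesis unfolding N_def
      using sum_permutations_compose_right[OF t, of "\<lambda>\<rho>. if \<rho> 0 = Suc (\<rho> j) then B (\<rho> j) else 0"]
      by (simp only:)
  qed
  have sumN: "of_nat (l - 1) * N 1 = (\<Sum>\<rho>\<in>?P. h (\<rho> 0))"
  proof -
    have "of_nat (l - 1) * N 1 = (\<Sum>j\<in>{0<..<l}. N 1)" by simp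
    also have "\<dots> = (\<Sum>j\<in>{0<..<l}. N j)" by (intro sum.cong refl N[symmetric])
    also have "\<dots> = (\<Sum>\<rho>\<in>?P. \<Sum>j\<in>{0<..<l}. if \<rho> 0 = Suc (\<rho> j) then B (\<rho> j) else 0)"
      unfolding N_def by (rule sum.swap)
    also have "\<dots> = (\<Sum>\<rho>\<in>?P. h (\<rho> 0))"
    proof (intro sum.cong refl)
      fix \<rho> assume "\<rho> \<in> ?P"
      then have \<rho>: "\<rho> permutes {..<l}" by simp
      have lt: "\<rho> 0 < l" using permutes_in_image[OF \<rho>, of 0] l by simp
      have "(\<Sum>j\<in>{0<..<l}. if \<rho> 0 = Suc (\<rho> j) then B (\<rho> j) else 0) =
          (\<Sum>j<l. if \<rho> 0 = Suc (\<rho> j) then B (\<rho> j) else 0)"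
        unfolding split by simp
      also have "\<dots> = (\<Sum>r<l. if \<rho> 0 = Suc r then B r else 0)"
        using sum.permute[OF \<rho>, of "\<lambda>r. if \<rho> 0 = Suc r then B r else 0"] by (simp add: o_def)
      also have "\<dots> = h (\<rho> 0)"
        using lt by (cases "\<rho> 0") (simp_all add: h_def)
      finally show "(\<Sum>j\<in>{0<..<l}. if \<rho> 0 = Suc (\<rho> j) then B (\<rho> j) else 0) = h (\<rho> 0)" .
    qed
    finally show ?thesis .
  qed
  have D: "(\<Sum>\<rho>\<in>?P. \<Sum>j\<in>{0<..<l}. if \<rho> 0 = Suc (\<rho> j) then B (\<rho> j) * x j ^ 2 else 0) = - (x 0 ^ 2 * N 1)"
  proof -
    have "(\<Sum>\<rho>\<in>?P. \<Sum>j\<in>{0<..<l}. if \<rho> 0 = Suc (\<rho> j) then B (\<rho> j) * x j ^ 2 else 0) =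
        (\<Sum>j\<in>{0<..<l}. x j ^ 2 * N j)"
      unfolding N_def sum_distrib_left by (subst sum.swap) (intro sum.cong refl, simp)
    also have "\<dots> = (\<Sum>j\<in>{0<..<l}. x j ^ 2 * N 1)" by (intro sum.cong refl) (simp only: N)
    also have "\<dots> = (\<Sum>j\<in>{0<..<l}. x j ^ 2) * N 1" by (simp only: sum_distrib_right)
    also have "(\<Sum>j\<in>{0<..<l}. x j ^ 2) = - (x 0 ^ 2)"
      using sq unfolding split by (simp add: eq_neg_iff_add_eq_0 add.commute)
    finally show ?thesis by simp
  qed
  obtain k where k: "l = Suc k" using l by (cases l) auto
  have "(\<Sum>a<l. h a) = S"
  proof -
    have "(\<Sum>a<l. h a) = (\<Sum>a<k. B a)" unfolding k sum.lessThan_Suc_shift by (simp add: h_def)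
    \<comment> \<open>The shift by one loses only the last value of \<open>B\<close>, which is
      \<open>1 choose 2\<close>.\<close>
    moreover have "B k = 0" by (simp add: B_def k choose_two)
    ultimately show ?thesis by (simp add: S_def k)
  qed
  then have H: "of_nat l * (\<Sum>\<rho>\<in>?P. h (\<rho> 0)) = of_nat (fact l) * S"
    using sum_permutes_apply[of l h] l by simp
  have P: "of_nat l * (\<Sum>\<rho>\<in>?P. B (\<rho> 0)) = of_nat (fact l) * S"
    using sum_permutes_apply[of l B] l by (simp add: S_def)
  have S: "6 * S = of_nat l * of_nat (l - 1) * (4 * of_nat l + 1)"
  proof -
    have "S = of_nat (\<Sum>a<l. (2 * a + 1) choose 2)"
      unfolding S_def B_def of_nat_sum
      using sum.nat_diff_reindex[of "\<lambda>a. of_nat ((2 * a + 1) choose 2) :: 'a" l] by simp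
    moreover have "of_nat (6 * (\<Sum>a<l. (2 * a + 1) choose 2) + l * (4 * l + 1)) = (of_nat (l * l * (4 * l + 1)) :: 'a)"
      by (simp only: six_times_sum_choose_2)
    ultimately have "6 * S + of_nat l * (4 * of_nat l + 1) = of_nat l * of_nat l * (4 * of_nat l + 1)"
      by (simp only: of_nat_add of_nat_mult of_nat_numeral of_nat_1)
    then show ?thesis by (simp add: k algebra_simps)
  qed
  let ?Q = "(\<Sum>\<rho>\<in>?P. B (\<rho> 0)) + N 1"
  have "of_nat l * (of_nat (l - 1) * ?Q) = of_nat (l - 1) * (of_nat (fact l) * S) + of_nat (fact l) * S"
    using P H sumN by (simp add: algebra_simps)
  also have "\<dots> = of_nat l * (of_nat (fact l) * S)" by (simp add: k algebra_simps)
  finally have "of_nat (l - 1) * ?Q = of_nat (fact l) * S" using nz by simp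
  then have "6 * (of_nat (l - 1) * ?Q) = 6 * (of_nat (fact l) * S)" by (rule arg_cong)
  then have "of_nat (l - 1) * (6 * ?Q) = of_nat (fact l) * (6 * S)" by (simp only: mult.left_commute)
  then have "of_nat (l - 1) * (6 * ?Q) = of_nat (l - 1) * (of_nat (fact l) * of_nat l * (4 * of_nat l + 1))"
    unfolding S by (simp only: mult_ac)
  then have Q: "6 * ?Q = of_nat (fact l) * of_nat l * (4 * of_nat l + 1)" using nz by simp
  have "weighted_sum l x 2 = \<kappa> * ((-1) ^ l * (x 0 ^ 2 * ?Q))"
    unfolding W2 B_def[symmetric] D by (simp add: distrib_left)
  then have "6 * weighted_sum l x 2 = \<kappa> * ((-1) ^ l * (x 0 ^ 2 * (6 * ?Q)))" by (simp only: mult_ac)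
  then show "6 * weighted_sum l x 2 = x 0 ^ 2 * (of_nat l * (4 * of_nat l + 1)) * weighted_sum l x 0"
    unfolding Q W0 by (simp only: mult_ac)
qed

section \<open>Roots of unity and equivariant maps\<close>

definition unity :: "nat \<Rightarrow> 'a::field set" where
  "unity n = {x. x ^ n = 1}"

text \<open>The condition at 0 is stated separately because for \<open>n = 1\<close> the
  equivariance is void.\<close>

definition unity_equivariant :: "nat \<Rightarrow> ('a::field \<Rightarrow> 'a) \<Rightarrow> bool" where
  "unity_equivariant n \<theta> \<longleftrightarrow> \<theta> 0 = 0 \<and> (\<forall>\<omega>\<in>unity n. \<forall>x. \<theta> (\<omega> * x) = \<omega> * \<theta> x)"

lemma one_in_unity [simp]: "1 \<in> unity n"
  by (simp add: unity_def)

lemma unity_1 [simp]: "unity 1 = {1}" "unity (Suc 0) = {1}"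
  by (auto simp: unity_def)

lemma zero_notin_unity [simp]: "n > 0 \<Longrightarrow> 0 \<notin> unity n"
  by (simp add: unity_def power_0_left)

lemma unity_mult: "x \<in> unity n \<Longrightarrow> y \<in> unity n \<Longrightarrow> x * y \<in> unity n"
  by (simp add: unity_def power_mult_distrib)

lemma unity_divide: "x \<in> unity n \<Longrightarrow> y \<in> unity n \<Longrightarrow> x / y \<in> unity n"
  by (simp add: unity_def power_divide)

lemma unity_mono:
  assumes "m dvd n"
  shows "unity m \<subseteq> unity n"
proof
  fix x :: 'a assume "x \<in> unity m"
  moreover obtain k where "n = m * k" using assms by (auto elim: dvdE)
  ultimately show "x \<in> unity n" by (simp add: unity_def power_mult)
qed

lemma unity_equivariant_mono:
  assumes "unity_equivariant n \<theta>" "m dvd n"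
  shows "unity_equivariant m \<theta>"
  using assms(1) unity_mono[OF assms(2)] unfolding unity_equivariant_def by blast

lemma image_mult_unity:
  assumes "\<omega> \<in> unity n" "n > 0"
  shows "(*) \<omega> ` unity n = unity n"
proof -
  have "\<omega> \<noteq> 0" using assms by auto
  have "x \<in> (*) \<omega> ` unity n" if "x \<in> unity n" for x
    using that unity_divide[OF that assms(1)] \<open>\<omega> \<noteq> 0\<close> by (intro image_eqI[of _ _ "x / \<omega>"]) auto
  then show ?thesis using unity_mult[OF assms(1)] by auto
qed

text \<open>Multiplication by \<open>\<omega>\<close> permutes \<open>A\<close> but scales the sum
  by \<open>\<omega> ^ p\<close>. This is the test by which a set is shown not to be a union of
  cosets.\<close>

lemma sum_power_invariant:
  fixes \<omega> :: "'a::field"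
  assumes "(*) \<omega> ` A = A" "\<omega> \<noteq> 0" "\<omega> ^ p \<noteq> 1"
  shows "(\<Sum>x\<in>A. x ^ p) = 0"
proof -
  have "inj_on ((*) \<omega>) A" using assms(2) by (auto intro: inj_onI)
  then have "(\<Sum>x\<in>A. x ^ p) = (\<Sum>x\<in>A. (\<omega> * x) ^ p)"
    using sum.reindex[of "(*) \<omega>" A "\<lambda>x. x ^ p"] assms(1) by (simp add: o_def)
  also have "\<dots> = \<omega> ^ p * (\<Sum>x\<in>A. x ^ p)" by (simp add: power_mult_distrib sum_distrib_left)
  finally show ?thesis using assms(3) by auto
qed

lemma unity_eq_powers:
  fixes g :: "'a::finite_field"
  assumes g: "generates_units g" and n: "n dvd CARD('a) - 1"
  shows "unity n = (\<lambda>i. g ^ ((CARD('a) - 1) div n * i)) ` {..<n}"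
    and "card (unity n :: 'a set) = n"
proof -
  define k where "k = (CARD('a) - 1) div n"
  have M: "CARD('a) - 1 = k * n" using n by (simp add: k_def)
  moreover have "CARD('a) - 1 > 0" using CARD_field_ge_2[where 'a='a] by simp
  ultimately have pos: "k > 0" "n > 0" by auto
  have one: "g ^ i = 1 \<longleftrightarrow> k * n dvd i" for i
    using generates_units_power_eq_1_iff[OF g] M by simp
  have g0: "g \<noteq> 0" by (rule generates_units_neq_0[OF g])
  show *: "unity n = (\<lambda>i. g ^ ((CARD('a) - 1) div n * i)) ` {..<n}"
    unfolding k_def[symmetric]
  proof (intro equalityI subsetI)
    fix x :: 'a assume x: "x \<in> unity n"
    then have "x \<noteq> 0" using pos by auto
    then obtain j where j: "x = g ^ j" by (rule generates_units_obtain[OF g])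
    then have "g ^ (j * n) = 1" using x by (simp add: unity_def power_mult)
    then have "k dvd j" using pos by (simp add: one)
    then obtain i where i: "j = k * i" by (auto elim: dvdE)
    have "k * i = k * (i mod n) + k * n * (i div n)"
      by (metis add_mult_distrib2 mod_mult_div_eq mult.assoc)
    then have "x = g ^ (k * (i mod n)) * g ^ (k * n * (i div n))"
      unfolding j i by (metis power_add)
    moreover have "g ^ (k * n * (i div n)) = 1" by (simp only: one dvd_triv_left)
    ultimately show "x \<in> (\<lambda>i. g ^ (k * i)) ` {..<n}" using pos by auto
  next
    fix x :: 'a assume "x \<in> (\<lambda>i. g ^ (k * i)) ` {..<n}"
    then obtain i where "x = g ^ (k * i)" by blast
    then have "x ^ n = g ^ (k * n * i)" by (simp add: power_mult[symmetric] mult_ac)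
    then show "x \<in> unity n" unfolding unity_def by (simp only: one dvd_triv_left mem_Collect_eq)
  qed
  have "i = j" if "g ^ (k * i) = g ^ (k * j)" "i \<le> j" "j < n" for i j
  proof -
    have "g ^ (k * j) = g ^ (k * i) * g ^ (k * (j - i))"
      by (metis that(2) le_add_diff_inverse distrib_left power_add)
    then have "g ^ (k * (j - i)) = 1" using that g0 by simp
    then have "n dvd j - i" using pos by (simp add: one)
    then show ?thesis using that by (auto dest: dvd_imp_le)
  qed
  then have "inj_on (\<lambda>i. g ^ (k * i)) {..<n}"
    by (intro inj_onI) (metis lessThan_iff nat_le_linear)
  then show "card (unity n :: 'a set) = n"
    unfolding * k_def[symmetric] by (simp add: card_image)
qed

text \<open>The power \<open>g ^ ((q - 1) div N)\<close> has order exactly \<open>N\<close>.\<close>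

lemma unity_not_subset:
  fixes g :: "'a::finite_field"
  assumes g: "generates_units g" and N: "N dvd CARD('a) - 1" and "\<not> N dvd n"
  obtains \<omega> :: 'a where "\<omega> \<in> unity N" "\<omega> \<notin> unity n"
proof -
  define k where "k = (CARD('a) - 1) div N"
  have M: "CARD('a) - 1 = k * N" using N by (simp add: k_def)
  moreover have "CARD('a) - 1 > 0" using CARD_field_ge_2[where 'a='a] by simp
  ultimately have pos: "k > 0" by auto
  have one: "g ^ i = 1 \<longleftrightarrow> k * N dvd i" for i
    using generates_units_power_eq_1_iff[OF g] M by simp
  have "g ^ k \<in> unity N" by (simp add: unity_def one flip: power_mult)
  moreover have "g ^ k \<notin> unity n" using assms(3) pos by (simp add: unity_def one flip: power_mult)
  ultimately show thesis by (rule that)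
qed

text \<open>The class \<open>C_{k,0}\<close> consists of the roots of unity of order dividing
  \<open>(q - 1) div k\<close>. Having a constant multiplier on each of its cosets is the same as
  commuting with multiplication by its elements.\<close>

lemma cyclotomic_orthomorphisms_eq:
  fixes g :: "'a::finite_field"
  assumes g: "generates_units g" and k: "k dvd CARD('a) - 1"
  shows "cyclotomic_orthomorphisms g k =
    {\<theta>. orthomorphism \<theta> \<and> unity_equivariant ((CARD('a) - 1) div k) \<theta>}"
proof -
  define n where "n = (CARD('a) - 1) div k"
  have M: "CARD('a) - 1 = k * n" using k by (simp add: n_def)
  moreover have "CARD('a) - 1 > 0" using CARD_field_ge_2[where 'a='a] by simp
  ultimately have pos: "k > 0" "n > 0" by auto
  have unity: "unity n = (\<lambda>i. g ^ (k * i)) ` {..<n}"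
    using unity_eq_powers(1)[OF g, of n] M pos by simp
  have in_unity: "g ^ (k * i) \<in> unity n" for i
    using generates_units_power_eq_1_iff[OF g, of "k * i * n"] M
    by (simp add: unity_def mult_ac flip: power_mult)
  have "(\<exists>m. cyclotomic_map g k m \<theta>) \<longleftrightarrow> unity_equivariant n \<theta>" for \<theta>
  proof
    assume "\<exists>m. cyclotomic_map g k m \<theta>"
    then obtain m where m: "\<theta> 0 = 0" "\<And>i x. i < k \<Longrightarrow> x \<in> cyclotomy_class g k i \<Longrightarrow> \<theta> x = m i * x"
      unfolding cyclotomic_map_def by blast
    have "\<theta> (g ^ (k * i) * x) = g ^ (k * i) * \<theta> x" for i x
    proof (cases "x = 0")
      case False
      then obtain j where j: "x = g ^ j" by (rule generates_units_obtain[OF g])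
      have "x \<in> cyclotomy_class g k (j mod k)" "g ^ (k * i) * x \<in> cyclotomy_class g k (j mod k)"
        unfolding cyclotomy_class_def j by (auto simp: cong_def simp flip: power_add)
      then show ?thesis using m(2)[of "j mod k"] pos by simp
    qed (simp add: m)
    then show "unity_equivariant n \<theta>"
      unfolding unity_equivariant_def unity using m(1) by auto
  next
    assume eq: "unity_equivariant n \<theta>"
    have "\<theta> x = \<theta> (g ^ i) / g ^ i * x" if i: "i < k" "x \<in> cyclotomy_class g k i" for i x
    proof -
      obtain j where j: "x = g ^ j" "[j = i] (mod k)" using i unfolding cyclotomy_class_def by blast
      then have "j mod k = i" using i by (simp add: cong_def)
      then have "j = k * (j div k) + i" by (metis mult_div_mod_eq)
      then have x: "x = g ^ (k * (j div k)) * g ^ i" unfolding j by (metis power_add)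
      have "\<theta> x = g ^ (k * (j div k)) * \<theta> (g ^ i)"
        using eq in_unity unfolding unity_equivariant_def x by blast
      then show ?thesis using generates_units_neq_0[OF g] by (simp add: x)
    qed
    then have "cyclotomic_map g k (\<lambda>i. \<theta> (g ^ i) / g ^ i) \<theta>"
      using eq unfolding cyclotomic_map_def unity_equivariant_def by blast
    then show "\<exists>m. cyclotomic_map g k m \<theta>" by blast
  qed
  then show ?thesis unfolding cyclotomic_orthomorphisms_def n_def[symmetric] by simp
qed

text \<open>Up to sign every nonzero element lies in \<open>K\<close>, so a collision of an odd map
  gives a collision of squares on \<open>K\<close> or a value equal to its own negative. This
  matches what nonvanishing alternating sums of squares guarantee.\<close>

lemma inj_odd:
  fixes \<phi> :: "'a::field \<Rightarrow> 'a"
  assumes odd: "\<And>y. \<phi> (- y) = - \<phi> y" and two: "(2 :: 'a) \<noteq> 0"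
    and K: "\<And>y. y \<noteq> 0 \<Longrightarrow> y \<in> K \<or> - y \<in> K"
    and inj: "inj_on (\<lambda>y. \<phi> y ^ 2) K" and nz: "\<And>y. y \<in> K \<Longrightarrow> \<phi> y \<noteq> 0"
  shows "inj \<phi>"
proof -
  have "2 * \<phi> 0 = 0" using odd[of 0] by (simp add: eq_neg_iff_add_eq_0)
  then have zero: "\<phi> 0 = 0" using two by simp
  have nz': "\<phi> y \<noteq> 0" if "y \<noteq> 0" for y
    using K[OF that] nz[of y] nz[of "- y"] odd[of y] by auto
  have "y = z" if eq: "\<phi> y = \<phi> z" and y: "y \<in> K" and "z \<noteq> 0" for y z
  proof (cases "z \<in> K")
    case True
    then show ?thesis using inj_onD[OF inj, of y z] y eq by simp
  next
    case False
    then have z: "- z \<in> K" using K \<open>z \<noteq> 0\<close> by blast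
    moreover have "\<phi> (- z) ^ 2 = \<phi> y ^ 2" using odd[of z] eq by simp
    ultimately have "y = - z" using inj_onD[OF inj, of y "- z"] y by simp
    then have "\<phi> z = - \<phi> z" using odd[of z] eq by simp
    then have "2 * \<phi> z = 0" by (simp add: eq_neg_iff_add_eq_0)
    then show ?thesis using two nz'[OF \<open>z \<noteq> 0\<close>] by simp
  qed note K_case = this
  show ?thesis
  proof (rule injI)
    fix y z assume eq: "\<phi> y = \<phi> z"
    show "y = z"
    proof (cases "y = 0 \<or> z = 0")
      case True
      then show ?thesis using eq zero nz' by metis
    next
      case False
      then consider "y \<in> K" | "- y \<in> K" using K by blast
      then show ?thesis
      proof cases
        case 1
        then show ?thesis using K_case eq False by blast
      next
        case 2
        then have "- y = - z" using K_case[of "- y" "- z"] odd eq False by simp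
        then show ?thesis by simp
      qed
    qed
  qed
qed

section \<open>Odd orthomorphisms over prime fields\<close>

text \<open>If all odd orthomorphisms were linear, the weighted sums could also be computed by
  summing over the multiplier, and comparing with \<open>weighted_sum_ratio\<close> would give \<open>7 = 0\<close>.\<close>

lemma exists_nonlinear_odd_orthomorphism_prime:
  fixes g :: "'a::finite_field" and l :: nat
  assumes g: "generates_units g" and card: "CARD('a) = 2 * l + 1" and prime: "prime CARD('a)"
    and odd: "odd l" and l: "l > 3"
  shows "\<exists>\<theta> :: 'a \<Rightarrow> 'a. orthomorphism \<theta> \<and> (\<forall>y. \<theta> (- y) = - \<theta> y) \<and> \<not> (\<forall>y. \<theta> y = \<theta> 1 * y)"
proof (rule ccontr)
  assume nex: "\<not> ?thesis"
  then have lin: "\<theta> y = \<theta> 1 * y" if "orthomorphism \<theta>" "\<And>y. \<theta> (- y) = - \<theta> y" for \<theta> :: "'a \<Rightarrow> 'a" and y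
    using that nex by blast
  have M: "CARD('a) - 1 = 2 * l" using card by simp
  have char: "CHAR('a) = CARD('a)"
    using CHAR_dvd_CARD[where 'a='a] prime by (metis CHAR_not_1' One_nat_def prime_nat_iff)
  have of_nat_0: "of_nat n = (0 :: 'a) \<longleftrightarrow> CARD('a) dvd n" for n
    by (simp add: of_nat_eq_0_iff_char_dvd char)
  have small: "of_nat n \<noteq> (0 :: 'a)" if "0 < n" "n < CARD('a)" for n
    using that by (auto simp: of_nat_0 dest: dvd_imp_le)
  have two: "(2 :: 'a) \<noteq> 0" using small[of 2] card l by simp
  have three: "(3 :: 'a) \<noteq> 0" using small[of 3] card l by simp
  have fact: "of_nat (fact l) \<noteq> (0 :: 'a)"
    using prime_dvd_fact_iff[OF prime, of l] card by (simp add: of_nat_0)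
  \<comment> \<open>The nonzero squares. As \<open>l\<close> is odd, \<open>-1\<close> is not among
    them, so \<open>K\<close> contains exactly one element of each pair \<open>y, - y\<close> of
    units.\<close>
  define K :: "'a set" where "K = unity l"
  have "card K = l" unfolding K_def by (rule unity_eq_powers(2)[OF g]) (use M in simp)
  then obtain x where x: "bij_betw x {..<l} K"
    using ex_bij_betw_nat_finite[of K] by (auto simp: atLeast0LessThan)
  have xK: "x i \<in> K" if "i < l" for i using x that by (auto simp: bij_betw_def)
  have x0: "x i \<noteq> 0" if "i < l" for i using xK[OF that] l by (auto simp: K_def)
  have K: "y \<in> K \<or> - y \<in> K" if "y \<noteq> 0" for y
  proof -
    have "(y ^ l) ^ 2 = 1"
      using power_CARD_minus_1[OF that] M by (simp add: mult.commute flip: power_mult)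
    then have "y ^ l = 1 \<or> y ^ l = -1" by (simp add: power2_eq_1_iff)
    then show ?thesis using odd by (auto simp: K_def unity_def)
  qed
  have notK: "- y \<notin> K" if "y \<in> K" for y
  proof
    assume "- y \<in> K"
    then have "(1 :: 'a) = -1" using that odd by (simp add: K_def unity_def)
    then show False using two by (simp add: eq_neg_iff_add_eq_0)
  qed
  have sq: "(\<Sum>i<l. x i ^ 2) = 0"
  proof -
    have "(\<Sum>i<l. x i ^ 2) = (\<Sum>y\<in>K. y ^ 2)" by (rule sum.reindex_bij_betw[OF x])
    also have "\<dots> = 0"
    proof (rule sum_power_invariant)
      \<comment> \<open>The sum of squares over \<open>K\<close> vanishes because
        \<open>g ^ 2\<close> lies in \<open>K\<close> and \<open>g ^ 4 \<noteq> 1\<close>, as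
        \<open>2 * l > 4\<close>.\<close>
      have "g ^ 2 \<in> unity l"
        using generates_units_power_eq_1_iff[OF g, of "2 * l"] M by (simp add: unity_def flip: power_mult)
      then show "(*) (g ^ 2) ` K = K" unfolding K_def by (rule image_mult_unity) (use l in simp)
      show "g ^ 2 \<noteq> 0" using generates_units_neq_0[OF g] by simp
      show "(g ^ 2) ^ 2 \<noteq> 1"
        using generates_units_power_eq_1_iff[OF g, of 4] M l
        by (auto dest: dvd_imp_le simp flip: power_mult)
    qed
    finally show ?thesis .
  qed
  \<comment> \<open>\<open>T f e\<close> is the summand of the weighted sum, and \<open>L c\<close>
    is the linear map with multiplier \<open>c\<close>, recorded by its values on
    \<open>K\<close>.\<close>
  define T where "T f e = f 0 ^ e * (\<Prod>i<l. f i * (f i - x i)) *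
     alt_sum l (\<lambda>i. f i ^ 2) * alt_sum l (\<lambda>i. (f i - x i) ^ 2)" for f e
  define L where "L c = (\<lambda>i\<in>{..<l}. c * x i)" for c
  have linT: "f \<in> range L" if f: "f \<in> PiE {..<l} (\<lambda>_. UNIV)" and "T f e \<noteq> 0" for f e
  proof -
    have nz: "f i \<noteq> 0" "f i \<noteq> x i" if "i < l" for i
      using \<open>T f e \<noteq> 0\<close> that by (auto simp: T_def)
    have inj: "inj_on h {..<l}" if "alt_sum l h \<noteq> 0" for h :: "nat \<Rightarrow> 'a"
      using that two by (intro inj_onI) (metis alt_sum_eq_0 lessThan_iff)
    have inj1: "inj_on (\<lambda>i. f i ^ 2) {..<l}" and inj2: "inj_on (\<lambda>i. (f i - x i) ^ 2) {..<l}"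
      using \<open>T f e \<noteq> 0\<close> by (auto simp: T_def intro!: inj)
    define idx where "idx = the_inv_into {..<l} x"
    have idx: "idx y < l" "x (idx y) = y" if "y \<in> K" for y
      using that x f_the_inv_into_f_bij_betw[OF x] bij_betwE[OF bij_betw_the_inv_into[OF x]]
      by (auto simp: idx_def)
    have idx_inj: "inj_on idx K" using bij_betw_the_inv_into[OF x] by (simp add: idx_def bij_betw_def)
    have idx_image: "idx ` K = {..<l}" using bij_betw_the_inv_into[OF x] by (simp add: idx_def bij_betw_def)
    \<comment> \<open>The odd extension of \<open>f\<close>. A nonzero summand makes it an
      orthomorphism, so by assumption it is linear.\<close>
    define \<theta> where "\<theta> y = (if y \<in> K then f (idx y) else if - y \<in> K then - f (idx (- y)) else 0)" for y
    have \<theta>_odd: "\<theta> (- y) = - \<theta> y" for y using notK[of y] notK[of "- y"] by (auto simp: \<theta>_def)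
    have "inj \<theta>"
    proof (rule inj_odd[where \<phi> = \<theta> and K = K])
      have "inj_on ((\<lambda>i. f i ^ 2) \<circ> idx) K"
        by (rule comp_inj_on) (use idx_inj inj1 idx_image in auto)
      then show "inj_on (\<lambda>y. \<theta> y ^ 2) K" by (simp add: \<theta>_def inj_on_def)
    qed (use nz idx \<theta>_odd two K in \<open>auto simp: \<theta>_def\<close>)
    moreover have "inj (\<lambda>y. \<theta> y - y)"
    proof (rule inj_odd[where \<phi> = "\<lambda>y. \<theta> y - y" and K = K])
      have "inj_on ((\<lambda>i. (f i - x i) ^ 2) \<circ> idx) K"
        by (rule comp_inj_on) (use idx_inj inj2 idx_image in auto)
      then show "inj_on (\<lambda>y. (\<theta> y - y) ^ 2) K" by (simp add: \<theta>_def inj_on_def idx)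
      show "\<theta> y - y \<noteq> 0" if "y \<in> K" for y
        using nz(2)[OF idx(1)[OF that]] that by (simp add: \<theta>_def idx)
    qed (use two K in \<open>simp_all add: \<theta>_odd\<close>)
    ultimately have "orthomorphism \<theta>"
      unfolding orthomorphism_def by (simp add: bij_def finite_UNIV_inj_surj)
    then have eq: "\<theta> y = \<theta> 1 * y" for y using lin \<theta>_odd by blast
    have "idx (x i) = i" if "i < l" for i
      unfolding idx_def using x that by (simp add: bij_betw_def the_inv_into_f_f)
    then have "f i = \<theta> 1 * x i" if "i < l" for i
      using eq[of "x i"] xK[OF that] that by (simp add: \<theta>_def)
    then have "f = L (\<theta> 1)" using f by (auto simp: L_def fun_eq_iff PiE_def extensional_def)
    then show ?thesis by blast
  qed
  define A where "A = alt_sum l (\<lambda>i. x i ^ 2)"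
  define Q where "Q = (\<Prod>i<l. x i) ^ 2 * A ^ 2"
  have TL: "T (L c) e = x 0 ^ e * Q * (c ^ (l + e) * (c - 1) ^ l)" for c e
  proof (cases "c = 0 \<or> c = 1")
    case True
    have "L c 0 * (L c 0 - x 0) = 0" using True l by (auto simp: L_def)
    then have P0: "(\<Prod>i<l. L c i * (L c i - x i)) = 0" using l by (intro prod_zero) auto
    have c0: "c ^ (l + e) * (c - 1) ^ l = 0" using True l by auto
    show ?thesis unfolding T_def P0 c0 by simp
  next
    case False
    \<comment> \<open>Scaling \<open>x\<close> by \<open>d\<close> multiplies the alternating sum of
      squares by \<open>d ^ (l * (l - 1))\<close>. This is 1 because \<open>l - 1\<close> is even
      and \<open>2 * l = q - 1\<close>.\<close>
    have pow: "(d ^ 2) ^ (\<Sum>i<l. i) = 1" if "d \<noteq> 0" for d :: 'a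
    proof -
      have "2 * (\<Sum>i<l. i) = l * (l - 1)"
      proof (induction l)
        case (Suc l)
        then show ?case by (cases l) (auto simp: algebra_simps)
      qed simp
      moreover obtain m where "l = 2 * m + 1" using odd by (auto elim: oddE)
      ultimately have "2 * (\<Sum>i<l. i) = (CARD('a) - 1) * m" using M by simp
      then have "(d ^ 2) ^ (\<Sum>i<l. i) = (d ^ (CARD('a) - 1)) ^ m" by (simp only: flip: power_mult)
      then show ?thesis using power_CARD_minus_1[OF that] by simp
    qed
    have alt: "alt_sum l (\<lambda>i. (d * x i) ^ 2) = A" if "d \<noteq> 0" for d
      using alt_sum_mult_left[of l "d ^ 2" "\<lambda>i. x i ^ 2"] pow[OF that]
      by (simp add: A_def power_mult_distrib)
    have "alt_sum l (\<lambda>i. L c i ^ 2) = alt_sum l (\<lambda>i. (c * x i) ^ 2)"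
      by (rule alt_sum_cong) (simp add: L_def)
    then have 1: "alt_sum l (\<lambda>i. L c i ^ 2) = A" using alt[of c] False by simp
    have "alt_sum l (\<lambda>i. (L c i - x i) ^ 2) = alt_sum l (\<lambda>i. ((c - 1) * x i) ^ 2)"
      by (rule alt_sum_cong) (simp add: L_def left_diff_distrib)
    then have 2: "alt_sum l (\<lambda>i. (L c i - x i) ^ 2) = A" using alt[of "c - 1"] False by simp
    have "(\<Prod>i<l. L c i * (L c i - x i)) = (\<Prod>i<l. (c * (c - 1)) * (x i * x i))"
      by (rule prod.cong) (auto simp: L_def algebra_simps)
    also have "\<dots> = (c * (c - 1)) ^ l * (\<Prod>i<l. x i) ^ 2"
      by (simp add: prod.distrib power2_eq_square)
    finally have P: "(\<Prod>i<l. L c i * (L c i - x i)) = (c * (c - 1)) ^ l * (\<Prod>i<l. x i) ^ 2" .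
    have L0: "L c 0 = c * x 0" using l by (simp add: L_def)
    show ?thesis
      unfolding T_def 1 2 P L0 Q_def
      by (simp only: power_mult_distrib power_add power2_eq_square mult_ac)
  qed
  have W: "weighted_sum l x e = x 0 ^ e * Q * (\<Sum>c\<in>UNIV. c ^ (l + e) * (c - 1) ^ l)" for e
  proof -
    have "inj L"
    proof (rule injI)
      fix c d assume "L c = L d"
      then have "L c 0 = L d 0" by simp
      then show "c = d" using x0[of 0] l by (simp add: L_def)
    qed
    have "weighted_sum l x e = (\<Sum>f\<in>PiE {..<l} (\<lambda>_. UNIV). T f e)"
      by (simp add: weighted_sum_def T_def)
    also have "\<dots> = (\<Sum>f\<in>range L. T f e)"
    proof (rule sum.mono_neutral_right)
      show "finite (PiE {..<l} (\<lambda>_. UNIV :: 'a set))" by (rule finite_PiE) auto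
      show "range L \<subseteq> PiE {..<l} (\<lambda>_. UNIV)" by (auto simp: L_def split: if_splits)
      show "\<forall>f\<in>PiE {..<l} (\<lambda>_. UNIV) - range L. T f e = 0" using linT by blast
    qed
    also have "\<dots> = (\<Sum>c\<in>UNIV. T (L c) e)"
      by (simp add: sum.reindex[OF \<open>inj L\<close>])
    finally show ?thesis by (simp add: TL sum_distrib_left)
  qed
  \<comment> \<open>The total exponents are \<open>q - 1\<close> and \<open>q + 1\<close>, so the
    binomial coefficients \<open>l choose 0\<close> and \<open>l choose 2\<close> appear.\<close>
  have "(\<Sum>c\<in>(UNIV :: 'a set). c ^ (l + 0) * (c - 1) ^ l) = - 1"
    using sum_power_times_power_diff_UNIV[OF g, of "l + 0" l 1] l unfolding M by simp
  then have W0: "weighted_sum l x 0 = - Q" using W[of 0] by simp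
  have "(\<Sum>c\<in>(UNIV :: 'a set). c ^ (l + 2) * (c - 1) ^ l) = - of_nat (l choose 2)"
    using sum_power_times_power_diff_UNIV[OF g, of "l + 2" l 1] l unfolding M by simp
  then have W2: "weighted_sum l x 2 = - (x 0 ^ 2 * Q * of_nat (l choose 2))" using W[of 2] by simp
  have L: "of_nat l \<noteq> (0 :: 'a)" "of_nat (l - 1) \<noteq> (0 :: 'a)" using small[of l] small[of "l - 1"] card l by auto
  note ratio = weighted_sum_ratio[OF g M _ sq L fact]
  have "Q \<noteq> 0" using ratio(1) W0 l by auto
  have "2 * (l choose 2) = l * (l - 1)" using odd by (auto simp: choose_two elim!: oddE)
  then have ch: "2 * of_nat (l choose 2) = (of_nat l * (of_nat l - 1) :: 'a)"
    using l by (metis of_nat_mult of_nat_numeral of_nat_diff of_nat_1 Suc_leI gr_implies_not_zero not_gr_zero One_nat_def)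
  have "6 * weighted_sum l x 2 = x 0 ^ 2 * (of_nat l * (4 * of_nat l + 1)) * weighted_sum l x 0"
    by (rule ratio(2)) (use l in simp)
  then have "x 0 ^ 2 * Q * (3 * (2 * of_nat (l choose 2))) = x 0 ^ 2 * Q * (of_nat l * (4 * of_nat l + 1))"
    unfolding W0 W2 by (simp add: algebra_simps)
  then have "3 * (2 * of_nat (l choose 2)) = (of_nat l * (4 * of_nat l + 1) :: 'a)"
    using \<open>Q \<noteq> 0\<close> x0[of 0] l by simp
  then have "of_nat l * (3 * (of_nat l - 1)) = (of_nat l * (4 * of_nat l + 1) :: 'a)"
    unfolding ch by (simp add: algebra_simps)
  \<comment> \<open>Hence \<open>l = -4\<close> in the field, while
    \<open>2 * l = -1\<close>.\<close>
  then have "3 * (of_nat l - 1) = (4 * of_nat l + 1 :: 'a)" using L by simp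
  then have "of_nat l + 4 = (0 :: 'a)" by (simp add: algebra_simps)
  then have "2 * (of_nat l + 4) = (0 :: 'a)" by simp
  then have "2 * of_nat l + 1 + 7 = (0 :: 'a)" by (simp add: algebra_simps)
  moreover have "2 * of_nat l + 1 = (0 :: 'a)" using of_nat_CARD[where 'a='a] unfolding card by (simp add: add.commute)
  ultimately have "of_nat 7 = (0 :: 'a)" by simp
  then have "CARD('a) dvd 7" by (simp only: of_nat_0)
  then have "CARD('a) \<le> 7" by (rule dvd_imp_le) simp
  then show False using card l by simp
qed

section \<open>Modifying a linear orthomorphism on shifted cosets\<close>

definition shift :: "'a::field set \<Rightarrow> 'a \<Rightarrow> 'a set" where
  "shift B z = (\<lambda>b. b - z) ` B"

definition switch :: "'a::field \<Rightarrow> 'a \<Rightarrow> 'a set \<Rightarrow> 'a \<Rightarrow> 'a set \<Rightarrow> 'a \<Rightarrow> 'a \<Rightarrow> 'a" where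
  "switch c d B1 z1 B2 z2 x =
    (if x \<in> shift B1 z1 then d * x + (d - c) * z1
     else if x \<in> shift B2 z2 then d * x + (d - c) * z2 else c * x)"

lemma in_shift_iff: "x \<in> shift B z \<longleftrightarrow> x + z \<in> B"
  by (auto simp: shift_def image_iff algebra_simps)

lemma shift_empty [simp]: "shift {} z = {}" and shift_0 [simp]: "shift B 0 = B"
  by (simp_all add: shift_def)

text \<open>The point \<open>b - z\<close> goes to \<open>c * (r * b - z)\<close>, and
  multiplication by \<open>r\<close> permutes \<open>B\<close>.\<close>

lemma image_affine_shift:
  assumes "(*) r ` B = B" "d = r * c"
  shows "(\<lambda>x. d * x + (d - c) * z) ` shift B z = (*) c ` shift B z"
proof -
  have "(\<lambda>x. d * x + (d - c) * z) ` shift B z = (\<lambda>b. c * (b - z)) ` (*) r ` B"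
    unfolding shift_def image_image by (rule image_cong) (simp_all add: assms(2) algebra_simps)
  then show ?thesis by (simp add: assms(1) shift_def image_image)
qed

lemma bij_if_image_eq:
  fixes \<phi> :: "'a::finite_field \<Rightarrow> 'a"
  assumes "c \<noteq> 0" "\<phi> ` A = (*) c ` A" "\<And>x. x \<notin> A \<Longrightarrow> \<phi> x = c * x"
  shows "bij \<phi>"
proof -
  have "y \<in> range \<phi>" for y
  proof (cases "y / c \<in> A")
    case True
    then have "y \<in> (*) c ` A" using assms(1) by (intro image_eqI[of _ _ "y / c"]) auto
    then show ?thesis using assms(2) by blast
  next
    case False
    then have "\<phi> (y / c) = y" using assms by simp
    then show ?thesis by (metis rangeI)
  qed
  then have "surj \<phi>" by blast
  then show ?thesis by (simp add: bij_def finite_UNIV_surj_inj)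
qed

text \<open>Subtracting the identity from a switched map replaces \<open>c\<close> and
  \<open>d\<close> by \<open>c - 1\<close> and \<open>d - 1\<close> and keeps \<open>d - c\<close>.
  So the same image argument applies twice, with ratio \<open>r\<close> and then with ratio
  \<open>r'\<close>.\<close>

lemma orthomorphism_switch:
  fixes c :: "'a::finite_field"
  assumes c: "c \<noteq> 0" "c \<noteq> 1" and d: "d = r * c" "d - 1 = r' * (c - 1)"
    and B1: "(*) r ` B1 = B1" "(*) r' ` B1 = B1" and B2: "(*) r ` B2 = B2" "(*) r' ` B2 = B2"
    and disj: "shift B1 z1 \<inter> shift B2 z2 = {}"
  shows "orthomorphism (switch c d B1 z1 B2 z2)"
proof -
  let ?A = "shift B1 z1 \<union> shift B2 z2"
  let ?T = "switch c d B1 z1 B2 z2"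
  have T2: "x \<notin> shift B1 z1" if "x \<in> shift B2 z2" for x using disj that by blast
  have "?T ` shift B1 z1 = (\<lambda>x. d * x + (d - c) * z1) ` shift B1 z1"
    by (rule image_cong) (simp_all add: switch_def)
  moreover have "?T ` shift B2 z2 = (\<lambda>x. d * x + (d - c) * z2) ` shift B2 z2"
    by (rule image_cong) (simp_all add: switch_def T2)
  ultimately have "?T ` ?A = (*) c ` ?A"
    by (simp only: image_Un image_affine_shift[OF B1(1) d(1)] image_affine_shift[OF B2(1) d(1)])
  then have "bij ?T"
    by (rule bij_if_image_eq[OF c(1)]) (simp add: switch_def)
  moreover have "(\<lambda>x. ?T x - x) ` shift B1 z1 = (\<lambda>x. (d - 1) * x + ((d - 1) - (c - 1)) * z1) ` shift B1 z1"
    by (rule image_cong) (simp_all add: switch_def algebra_simps)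
  moreover have "(\<lambda>x. ?T x - x) ` shift B2 z2 = (\<lambda>x. (d - 1) * x + ((d - 1) - (c - 1)) * z2) ` shift B2 z2"
    by (rule image_cong) (simp_all add: switch_def T2 algebra_simps)
  ultimately have "(\<lambda>x. ?T x - x) ` ?A = (*) (c - 1) ` ?A"
    by (simp only: image_Un image_affine_shift[OF B1(2) d(2)] image_affine_shift[OF B2(2) d(2)])
  then have "bij (\<lambda>x. ?T x - x)"
    by (rule bij_if_image_eq[rotated]) (use c in \<open>simp_all add: switch_def algebra_simps\<close>)
  with \<open>bij ?T\<close> show ?thesis by (simp add: orthomorphism_def)
qed

text \<open>On a translate the change is \<open>(d - c) * (x + z)\<close> with \<open>x + z\<close>
  a nonzero element of \<open>B\<close>.\<close>

lemma switch_neq_iff: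
  assumes "c \<noteq> d" "0 \<notin> B1" "0 \<notin> B2"
  shows "switch c d B1 z1 B2 z2 x \<noteq> c * x \<longleftrightarrow> x \<in> shift B1 z1 \<union> shift B2 z2"
proof -
  have eq: "d * x + (d - c) * z = c * x \<longleftrightarrow> (d - c) * (x + z) = 0" for z
    by (simp add: algebra_simps)
  have "d * x + (d - c) * z \<noteq> c * x" if "x \<in> shift B z" "0 \<notin> B" for B z
    using that assms(1) unfolding eq by (auto simp: in_shift_iff)
  then show ?thesis using assms by (auto simp: switch_def)
qed

lemma unity_equivariant_imp_invariant:
  assumes "unity_equivariant n \<theta>" "\<omega> \<in> unity n" "n > 0"
  shows "(*) \<omega> ` {x. \<theta> x \<noteq> c * x} = {x. \<theta> x \<noteq> c * x}"
proof -
  have "\<omega> \<noteq> 0" using assms by auto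
  have eq: "\<theta> (\<omega> * x) = \<omega> * \<theta> x" for x using assms unfolding unity_equivariant_def by blast
  have iff: "\<theta> (\<omega> * x) \<noteq> c * (\<omega> * x) \<longleftrightarrow> \<theta> x \<noteq> c * x" for x
    using \<open>\<omega> \<noteq> 0\<close> by (simp add: eq mult.left_commute)
  show ?thesis
  proof (intro equalityI subsetI)
    fix x assume "x \<in> {x. \<theta> x \<noteq> c * x}"
    then have "x / \<omega> \<in> {x. \<theta> x \<noteq> c * x}" using iff[of "x / \<omega>"] \<open>\<omega> \<noteq> 0\<close> by simp
    then show "x \<in> (*) \<omega> ` {x. \<theta> x \<noteq> c * x}" using \<open>\<omega> \<noteq> 0\<close> by (intro image_eqI[of _ _ "x / \<omega>"]) auto
  qed (use iff in auto)
qed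

lemma exists_not_in_small:
  fixes A :: "'a::finite set"
  assumes "card A < CARD('a)"
  obtains z where "z \<notin> A"
  using assms by (metis UNIV_eq_I less_irrefl)

text \<open>The constant \<open>c\<close> solves \<open>r * c - 1 = r' * (c - 1)\<close>. Here
  \<open>r \<noteq> r'\<close> makes this solvable, \<open>r' \<noteq> 1\<close> gives
  \<open>c \<noteq> 0\<close>, and \<open>r \<noteq> 1\<close> gives
  \<open>c \<noteq> 1\<close>.\<close>

lemma exists_switch_multipliers:
  fixes g :: "'a::finite_field"
  assumes g: "generates_units g" and n: "n dvd CARD('a) - 1" "n \<ge> 3"
  obtains c d r r' :: 'a where "c \<noteq> 0" "c \<noteq> 1" "c \<noteq> d" "r \<in> unity n" "r' \<in> unity n"
    "d = r * c" "d - 1 = r' * (c - 1)"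
proof -
  have card: "card (unity n :: 'a set) = n" by (rule unity_eq_powers(2)[OF g n(1)])
  have "\<not> unity n \<subseteq> {1 :: 'a}"
    using card_mono[of "{1 :: 'a}" "unity n"] card n(2) by auto
  then obtain r :: 'a where r: "r \<in> unity n" "r \<noteq> 1" by blast
  have "\<not> unity n \<subseteq> {1, r}"
    using card_mono[of "{1, r}" "unity n"] card n(2) r by auto
  then obtain r' where r': "r' \<in> unity n" "r' \<noteq> 1" "r' \<noteq> r" by blast
  define c where "c = (1 - r') / (r - r')"
  have c: "c * (r - r') = 1 - r'" using r' by (simp add: c_def)
  show thesis
  proof (rule that[of c "r * c" r r'])
    show "c \<noteq> 0" using r' by (simp add: c_def)
    show "c \<noteq> 1" using c r by auto
    show "c \<noteq> r * c" using \<open>c \<noteq> 0\<close> r by auto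
    show "r * c - 1 = r' * (c - 1)" using c by (simp add: algebra_simps)
  qed (use r r' in auto)
qed

text \<open>Only the group of \<open>m\<close>-th roots of unity is switched: the multiplier is
  \<open>d\<close> at 1 but \<open>c\<close> at an \<open>N\<close>-th root of unity outside the
  group.\<close>

lemma exists_orthomorphism_switch_coset:
  fixes g :: "'a::finite_field"
  assumes g: "generates_units g" and m: "m dvd CARD('a) - 1" "m \<ge> 3"
    and N: "N dvd CARD('a) - 1" "\<not> N dvd m"
  shows "\<exists>\<theta> :: 'a \<Rightarrow> 'a. orthomorphism \<theta> \<and> unity_equivariant m \<theta> \<and> \<not> unity_equivariant N \<theta>"
proof -
  obtain c d r r' :: 'a where cd: "c \<noteq> 0" "c \<noteq> 1" "c \<noteq> d" "r \<in> unity m" "r' \<in> unity m"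
    "d = r * c" "d - 1 = r' * (c - 1)"
    using exists_switch_multipliers[OF g m] .
  let ?T = "switch c d (unity m) 0 {} 0"
  have inv: "(*) \<omega> ` unity m = unity m" if "\<omega> \<in> unity m" for \<omega> :: 'a
    using image_mult_unity[OF that] m by simp
  have "orthomorphism ?T"
    by (rule orthomorphism_switch[OF cd(1,2,6,7)]) (use inv cd in auto)
  moreover have "unity_equivariant m ?T"
  proof -
    have "\<omega> * x \<in> unity m \<longleftrightarrow> x \<in> unity m" if "\<omega> \<in> unity m" for \<omega> x :: 'a
      using that by (auto simp: unity_def power_mult_distrib)
    then show ?thesis using m by (simp add: unity_equivariant_def switch_def)
  qed
  moreover have "\<not> unity_equivariant N ?T"
  proof
    assume eq: "unity_equivariant N ?T"
    obtain \<omega> :: 'a where \<omega>: "\<omega> \<in> unity N" "\<omega> \<notin> unity m"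
      by (rule unity_not_subset[OF g N])
    then have "?T (\<omega> * 1) = \<omega> * ?T 1" using eq unfolding unity_equivariant_def by blast
    then have "c * \<omega> = \<omega> * d" using \<omega> by (simp add: switch_def)
    moreover have "\<omega> \<noteq> 0" using \<omega> N CARD_field_ge_2[where 'a='a] by (auto dest: dvd_pos_nat[rotated] intro: gr0I)
    ultimately show False using cd by simp
  qed
  ultimately show ?thesis by blast
qed

text \<open>The elements of the switched translate sum to \<open>- m * z\<close>, which is nonzero,
  so the translate is not invariant under a nontrivial root of unity. Choosing \<open>z\<close>
  outside the group keeps 0 fixed.\<close>

lemma exists_orthomorphism_switch_shifted:
  fixes g :: "'a::finite_field"
  assumes g: "generates_units g" and m: "m dvd CARD('a) - 1" "m \<ge> 3" "m < CARD('a) - 1"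
    and N: "N dvd CARD('a) - 1" "N \<ge> 2"
  shows "\<exists>\<theta> :: 'a \<Rightarrow> 'a. orthomorphism \<theta> \<and> unity_equivariant 1 \<theta> \<and> \<not> unity_equivariant N \<theta>"
proof -
  obtain c d r r' :: 'a where cd: "c \<noteq> 0" "c \<noteq> 1" "c \<noteq> d" "r \<in> unity m" "r' \<in> unity m"
    "d = r * c" "d - 1 = r' * (c - 1)"
    using exists_switch_multipliers[OF g m(1,2)] .
  have card: "card (unity m :: 'a set) = m" by (rule unity_eq_powers(2)[OF g m(1)])
  have "card (insert 0 (unity m :: 'a set)) < CARD('a)"
    using card_insert_le_m1[of "CARD('a) - 1" "unity m :: 'a set" 0] card m by (simp add: card_insert_if)
  then obtain z :: 'a where "z \<notin> insert 0 (unity m)" by (rule exists_not_in_small)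
  then have z: "z \<notin> unity m" "z \<noteq> 0" by auto
  let ?T = "switch c d (unity m) z {} 0"
  have inv: "(*) \<omega> ` unity m = unity m" if "\<omega> \<in> unity m" for \<omega> :: 'a
    using image_mult_unity[OF that] m by simp
  have "orthomorphism ?T"
    by (rule orthomorphism_switch[OF cd(1,2,6,7)]) (use inv cd in auto)
  moreover have "unity_equivariant 1 ?T"
    using z by (simp add: unity_equivariant_def switch_def in_shift_iff)
  moreover have "\<not> unity_equivariant N ?T"
  proof
    assume eq: "unity_equivariant N ?T"
    obtain \<omega> :: 'a where \<omega>: "\<omega> \<in> unity N" "\<omega> \<notin> unity 1"
      by (rule unity_not_subset[OF g N(1), of 1]) (use N in auto)
    have A: "{x. ?T x \<noteq> c * x} = shift (unity m) z"
      using switch_neq_iff[OF cd(3), of "unity m" "{}" z 0] m by auto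
    have "(\<Sum>x\<in>shift (unity m) z. x ^ 1) = 0"
      by (rule sum_power_invariant[of \<omega>])
         (use unity_equivariant_imp_invariant[OF eq \<omega>(1), of c] N \<omega> in \<open>auto simp: A\<close>)
    moreover have "(\<Sum>x\<in>shift (unity m) z. x) = (\<Sum>x\<in>unity m. x - z)"
      unfolding shift_def by (subst sum.reindex) (auto simp: inj_on_def)
    moreover have "\<dots> = (\<Sum>x\<in>unity m. x ^ 1) - of_nat m * z"
      by (simp add: sum_subtractf card)
    moreover have "(\<Sum>x\<in>unity m. x ^ 1) = (0 :: 'a)"
    proof -
      obtain \<eta> :: 'a where \<eta>: "\<eta> \<in> unity m" "\<eta> \<notin> unity 1"
        by (rule unity_not_subset[OF g m(1), of 1]) (use m in auto)
      then show ?thesis by (intro sum_power_invariant[of \<eta>] inv) (use m in auto)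
    qed
    ultimately have "of_nat m * z = 0" by simp
    then show False using z of_nat_dvd_CARD_minus_1_neq_0[OF m(1)] by simp
  qed
  ultimately show ?thesis by blast
qed

lemma unity_2: "unity 2 = {1, -1 :: 'a::field}"
  by (auto simp: unity_def power2_eq_1_iff)

text \<open>The condition on \<open>z\<close> makes the translate of the group disjoint from its
  negative, so both can be switched to give an odd map. The squares of the switched elements sum to
  \<open>2 * m * z ^ 2\<close>, which is nonzero.\<close>

lemma exists_orthomorphism_switch_shifted_odd:
  fixes g z :: "'a::finite_field"
  assumes g: "generates_units g" and two: "(2 :: 'a) \<noteq> 0"
    and m: "m dvd CARD('a) - 1" "m \<ge> 3" and N: "N dvd CARD('a) - 1" "m dvd N"
    and z: "z \<noteq> 0" "\<And>k k'. k \<in> unity m \<Longrightarrow> k' \<in> unity m \<Longrightarrow> 2 * z \<noteq> k + k'"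
  shows "\<exists>\<theta> :: 'a \<Rightarrow> 'a. orthomorphism \<theta> \<and> unity_equivariant 2 \<theta> \<and> \<not> unity_equivariant N \<theta>"
proof -
  obtain c d r r' :: 'a where cd: "c \<noteq> 0" "c \<noteq> 1" "c \<noteq> d" "r \<in> unity m" "r' \<in> unity m"
    "d = r * c" "d - 1 = r' * (c - 1)"
    using exists_switch_multipliers[OF g m] .
  define K :: "'a set" where "K = unity m"
  have card: "card K = m" unfolding K_def by (rule unity_eq_powers(2)[OF g m(1)])
  have N0: "N > 0" using N CARD_field_ge_2[where 'a='a] by (auto intro: gr0I)
  have K0: "0 \<notin> K" "0 \<notin> uminus ` K" using m by (auto simp: K_def)
  let ?T = "switch c d K z (uminus ` K) (- z)"
  have inv: "(*) \<omega> ` K = K" if "\<omega> \<in> unity m" for \<omega> :: 'a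
    using image_mult_unity[OF that] m by (simp add: K_def)
  have inv': "(*) \<omega> ` (uminus ` K) = uminus ` K" if "\<omega> \<in> unity m" for \<omega> :: 'a
  proof -
    have "(*) \<omega> ` (uminus ` K) = uminus ` ((*) \<omega> ` K)" by (simp add: image_image)
    then show ?thesis using inv[OF that] by simp
  qed
  have zK: "z \<notin> K" using z(2)[of z z] by (auto simp: K_def)
  have neg: "x \<in> shift (uminus ` K) (- z) \<longleftrightarrow> - x \<in> shift K z" for x
  proof -
    have "y \<in> uminus ` K \<longleftrightarrow> - y \<in> K" for y by force
    from this[of "x + - z"] show ?thesis by (simp add: in_shift_iff)
  qed
  have disj: "shift K z \<inter> shift (uminus ` K) (- z) = {}"
  proof -
    have False if "x \<in> shift K z" "- x \<in> shift K z" for x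
    proof -
      have "2 * z = (x + z) + (- x + z)" by simp
      moreover have "x + z \<in> unity m" "- x + z \<in> unity m" using that by (simp_all add: in_shift_iff K_def)
      ultimately show False using z(2) by blast
    qed
    then show ?thesis using neg by blast
  qed
  have "orthomorphism ?T"
    by (rule orthomorphism_switch[OF cd(1,2,6,7)]) (use inv inv' cd disj in auto)
  moreover have "unity_equivariant 2 ?T"
  proof -
    have "?T (- x) = - ?T x" for x
      using neg[of x] neg[of "- x"] disj by (auto simp: switch_def algebra_simps)
    moreover have "?T 0 = 0"
      using zK neg[of 0] by (simp add: switch_def in_shift_iff)
    ultimately show ?thesis by (simp add: unity_equivariant_def unity_2)
  qed
  moreover have "\<not> unity_equivariant N ?T"
  proof
    assume eq: "unity_equivariant N ?T"
    \<comment> \<open>One \<open>\<omega>\<close> serves twice: it lies in both groups of roots of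
      unity, and \<open>\<omega> ^ 2 \<noteq> 1\<close> makes the first two power sums over
      \<open>K\<close> vanish.\<close>
    obtain \<omega> :: 'a where \<omega>: "\<omega> \<in> unity m" "\<omega> \<notin> unity 2"
      by (rule unity_not_subset[OF g m(1), of 2]) (use m in \<open>auto dest: dvd_imp_le\<close>)
    then have \<omega>p: "\<omega> \<noteq> 0" "\<omega> ^ 2 \<noteq> 1" "\<omega> ^ 1 \<noteq> 1" using m by (auto simp: unity_def power_0_left)
    have "\<omega> \<in> unity N" using \<omega> unity_mono[OF N(2)] by blast
    have A: "{x. ?T x \<noteq> c * x} = shift K z \<union> shift (uminus ` K) (- z)"
      using switch_neq_iff[OF cd(3) K0] by blast
    have "(\<Sum>x\<in>shift K z \<union> shift (uminus ` K) (- z). x ^ 2) = 0"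
      by (rule sum_power_invariant[OF _ \<omega>p(1,2)])
         (use unity_equivariant_imp_invariant[OF eq \<open>\<omega> \<in> unity N\<close> N0, of c] in \<open>simp add: A\<close>)
    moreover have "(\<Sum>x\<in>shift K z \<union> shift (uminus ` K) (- z). x ^ 2) =
        (\<Sum>x\<in>shift K z. x ^ 2) + (\<Sum>x\<in>shift (uminus ` K) (- z). x ^ 2)"
      using disj by (intro sum.union_disjoint) auto
    moreover have "(\<Sum>x\<in>shift (uminus ` K) (- z). x ^ 2) = (\<Sum>x\<in>shift K z. x ^ 2)"
      by (rule sum.reindex_bij_witness[of _ uminus uminus]) (auto simp: neg)
    moreover have "(\<Sum>x\<in>shift K z. x ^ 2) = (\<Sum>x\<in>K. (x - z) ^ 2)"
      unfolding shift_def by (subst sum.reindex) (auto simp: inj_on_def)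
    moreover have "\<dots> = (\<Sum>x\<in>K. x ^ 2) - 2 * z * (\<Sum>x\<in>K. x ^ 1) + of_nat m * z ^ 2"
      by (simp add: power2_diff sum_subtractf sum.distrib card sum_distrib_left mult_ac)
    moreover have "(\<Sum>x\<in>K. x ^ 2) = 0" "(\<Sum>x\<in>K. x ^ 1) = 0"
      by (rule sum_power_invariant[OF inv[OF \<omega>(1)]]; rule \<omega>p)+
    ultimately have "2 * (of_nat m * z ^ 2) = 0" by simp
    then show False using two z(1) of_nat_dvd_CARD_minus_1_neq_0[OF m(1)] by simp
  qed
  ultimately show ?thesis by blast
qed

section \<open>Additive orthomorphisms in characteristics 2 and 3\<close>

lemma orthomorphism_additive:
  fixes \<theta> :: "'a::finite_field \<Rightarrow> 'a"
  assumes diff: "\<And>x y. \<theta> (x - y) = \<theta> x - \<theta> y"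
    and nz: "\<And>x. x \<noteq> 0 \<Longrightarrow> \<theta> x \<noteq> 0" "\<And>x. x \<noteq> 0 \<Longrightarrow> \<theta> x \<noteq> x"
  shows "orthomorphism \<theta>"
proof -
  have "inj \<theta>"
  proof (rule injI)
    fix x y assume "\<theta> x = \<theta> y"
    then have "\<theta> (x - y) = 0" by (simp add: diff)
    then show "x = y" using nz(1)[of "x - y"] by auto
  qed
  moreover have "inj (\<lambda>x. \<theta> x - x)"
  proof (rule injI)
    fix x y assume "\<theta> x - x = \<theta> y - y"
    then have "\<theta> (x - y) = x - y" by (simp add: diff algebra_simps)
    then show "x = y" using nz(2)[of "x - y"] by auto
  qed
  ultimately show ?thesis
    by (simp add: orthomorphism_def bij_def finite_UNIV_inj_surj)
qed

text \<open>The map \<open>x^4 + x^2 + \<gamma> x\<close> is additive, and injective iff \<open>\<gamma>\<close> is not of the form \<open>x^3 + x\<close>.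
  The latter map has the collisions \<open>{0, 1}\<close> and \<open>{s, g s}\<close>, so it misses two values.\<close>

lemma exists_nonlinear_orthomorphism_char_2:
  fixes g :: "'a::finite_field"
  assumes g: "generates_units g" and two: "(2 :: 'a) = 0" and card: "CARD('a) > 4"
  shows "\<exists>\<theta> :: 'a \<Rightarrow> 'a. orthomorphism \<theta> \<and> unity_equivariant 1 \<theta> \<and> \<not> unity_equivariant (CARD('a) - 1) \<theta>"
proof -
  have dbl: "x + x = 0" for x :: 'a using two by (metis mult_2 mult_zero_left)
  then have neg: "- x = x" for x :: 'a by (metis add_eq_0_iff)
  have sub: "x - y = x + y" for x y :: 'a by (metis neg diff_conv_add_uminus)
  have sq: "(x + y) ^ 2 = x ^ 2 + y ^ 2" for x y :: 'a by (simp add: power2_sum two)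
  have g0: "g \<noteq> 0" by (rule generates_units_neq_0[OF g])
  have gpow: "g ^ i \<noteq> 1" if "0 < i" "i < 4" for i
    using generates_units_power_eq_1_iff[OF g, of i] that card by (auto dest: dvd_imp_le)
  have g1: "g \<noteq> 1" "g ^ 2 \<noteq> 1" "g ^ 3 \<noteq> 1" using gpow[of 1] gpow[of 2] gpow[of 3] by simp_all
  have "g ^ 3 - 1 = (g - 1) * (g ^ 2 + g + 1)" by (simp add: power2_eq_square power3_eq_cube algebra_simps)
  then have g2: "g ^ 2 + g + 1 \<noteq> 0" using g1 by auto
  have "inj (\<lambda>x :: 'a. x ^ 2)"
  proof (rule injI)
    fix x y :: 'a assume "x ^ 2 = y ^ 2"
    then have "(x + y) ^ 2 = 0" by (simp add: sq dbl)
    then have "x + y = 0" by simp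
    then show "x = y" by (simp add: add_eq_0_iff neg)
  qed
  then have "surj (\<lambda>x :: 'a. x ^ 2)" by (simp add: finite_UNIV_inj_surj)
  \<comment> \<open>This choice solves \<open>(g ^ 2 + g + 1) * s ^ 2 + 1 = 0\<close>, the condition
    for \<open>f (g * s) = f s\<close>.\<close>
  then obtain s where s: "s ^ 2 = 1 / (g ^ 2 + g + 1)" by (metis surjD)
  then have s0: "s \<noteq> 0" using g2 by auto
  define f where "f x = x ^ 3 + x" for x :: 'a
  have f01: "f 1 = f 0" by (simp add: f_def dbl)
  have fs: "f (g * s) = f s"
  proof -
    have "f (g * s) - f s = s * (g - 1) * ((g ^ 2 + g + 1) * s ^ 2 + 1)"
      by (simp add: f_def power2_eq_square power3_eq_cube algebra_simps)
    also have "\<dots> = 0" using g2 by (simp add: s dbl)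
    finally show ?thesis by simp
  qed
  have f_eq_0: "x = 0 \<or> x = 1" if "f x = 0" for x
  proof -
    have "f x = x * (x ^ 2 + 1)" by (simp add: f_def power2_eq_square power3_eq_cube algebra_simps)
    also have "x ^ 2 + 1 = (x + 1) ^ 2" by (simp add: sq)
    finally have "f x = x * (x + 1) ^ 2" .
    then show ?thesis using that by (auto simp: add_eq_0_iff neg)
  qed
  have sn: "s \<noteq> 1" "g * s \<noteq> 1" "g * s \<noteq> s"
  proof -
    show "g * s \<noteq> s" using g1 s0 by simp
    show "s \<noteq> 1"
    proof
      assume "s = 1"
      then have "f g = 0" using fs by (simp add: f_def dbl)
      then show False using f_eq_0 g0 g1 by blast
    qed
    show "g * s \<noteq> 1"
    proof
      assume "g * s = 1"
      then have "f s = 0" using fs by (simp add: f_def dbl)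
      then show False using f_eq_0 s0 \<open>s \<noteq> 1\<close> by blast
    qed
  qed
  have "range f \<subseteq> f ` (UNIV - {1, g * s})"
  proof
    fix y assume "y \<in> range f"
    then obtain x where x: "y = f x" by blast
    consider "x = 1" | "x = g * s" | "x \<noteq> 1" "x \<noteq> g * s" by blast
    then show "y \<in> f ` (UNIV - {1, g * s})"
    proof cases
      case 1
      then show ?thesis using x f01 g0 s0 by (intro image_eqI[of _ _ 0]) auto
    next
      case 2
      then show ?thesis using x fs sn by (intro image_eqI[of _ _ s]) auto
    qed (use x in auto)
  qed
  then have "card (range f) \<le> card (UNIV - {1, g * s})"
    by (intro surj_card_le) auto
  also have "\<dots> = CARD('a) - 2" using sn by (simp add: card_Diff_subset)
  finally have fcard: "card (range f) \<le> CARD('a) - 2" .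
  then have "card (range f) < CARD('a)" using card by linarith
  then obtain \<gamma> where \<gamma>: "\<gamma> \<notin> range f" by (rule exists_not_in_small)
  have "card (insert \<gamma> (range f)) < CARD('a)" using fcard card \<gamma> by simp
  then obtain \<gamma>' where "\<gamma>' \<notin> insert \<gamma> (range f)" by (rule exists_not_in_small)
  then have \<gamma>': "\<gamma>' \<notin> range f" "\<gamma>' \<noteq> \<gamma>" by auto
  define p where "p c x = x ^ 4 + x ^ 2 + c * x" for c x :: 'a
  have pnz: "p c x \<noteq> 0" if "c \<notin> range f" "x \<noteq> 0" for c x
  proof
    assume "p c x = 0"
    moreover have "p c x = x * (f x + c)"
      by (simp add: p_def f_def power2_eq_square power3_eq_cube power4_eq_xxxx algebra_simps)
    ultimately have "f x + c = 0" using that by simp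
    then have "c = f x" by (simp add: add_eq_0_iff neg)
    then show False using that by blast
  qed
  have pdiff: "p c (x - y) = p c x - p c y" for c x y
  proof -
    have "(x + y) ^ 4 = ((x + y) ^ 2) ^ 2" by (simp flip: power_mult)
    also have "\<dots> = x ^ 4 + y ^ 4" by (simp add: sq flip: power_mult)
    finally show ?thesis by (simp add: p_def sub sq algebra_simps)
  qed
  \<comment> \<open>With this scaling, subtracting the identity just replaces
    \<open>\<gamma>\<close> by \<open>\<gamma>'\<close>.\<close>
  define \<theta> where "\<theta> x = p \<gamma> x / (\<gamma> - \<gamma>')" for x
  have \<theta>': "\<theta> x - x = p \<gamma>' x / (\<gamma> - \<gamma>')" for x
    using \<gamma>' by (simp add: \<theta>_def p_def field_simps)
  have "orthomorphism \<theta>"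
  proof (rule orthomorphism_additive)
    show "\<theta> (x - y) = \<theta> x - \<theta> y" for x y by (simp add: \<theta>_def pdiff diff_divide_distrib)
    show "\<theta> x \<noteq> 0" if "x \<noteq> 0" for x using pnz[OF \<gamma> that] \<gamma>' by (simp add: \<theta>_def)
    show "\<theta> x \<noteq> x" if "x \<noteq> 0" for x using pnz[OF \<gamma>'(1) that] \<gamma>' \<theta>'[of x] by auto
  qed
  moreover have "unity_equivariant 1 \<theta>" by (simp add: unity_equivariant_def \<theta>_def p_def)
  moreover have "\<not> unity_equivariant (CARD('a) - 1) \<theta>"
  proof
    assume "unity_equivariant (CARD('a) - 1) \<theta>"
    moreover have "g \<in> unity (CARD('a) - 1)" using power_CARD_minus_1[OF g0] by (simp add: unity_def)
    ultimately have "\<theta> (g * 1) = g * \<theta> 1" unfolding unity_equivariant_def by blast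
    then have "p \<gamma> g = g * p \<gamma> 1" using \<gamma>' by (simp add: \<theta>_def)
    then have "g * f g = 0"
      by (simp add: p_def f_def dbl power2_eq_square power3_eq_cube power4_eq_xxxx algebra_simps)
    then show False using f_eq_0 g0 g1 by auto
  qed
  ultimately show ?thesis by blast
qed

text \<open>In characteristic 3 the map \<open>x ^ 3 - c * x\<close> is additive, and it has trivial
  kernel if \<open>c\<close> is not a square. Scaled by the difference of two nonsquares,
  subtracting the identity exchanges one nonsquare for the other.\<close>

lemma exists_orthomorphism_char_3:
  fixes g :: "'a::finite_field"
  assumes g: "generates_units g" and three: "(3 :: 'a) = 0" and M: "CARD('a) - 1 = 2 * l" "l > 1"
    and N: "N dvd CARD('a) - 1" "N \<ge> 3"
  shows "\<exists>\<theta> :: 'a \<Rightarrow> 'a. orthomorphism \<theta> \<and> unity_equivariant 2 \<theta> \<and> \<not> unity_equivariant N \<theta>"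
proof -
  have g0: "g \<noteq> 0" by (rule generates_units_neq_0[OF g])
  have one: "g ^ i = 1 \<longleftrightarrow> 2 * l dvd i" for i
    using generates_units_power_eq_1_iff[OF g, of i] M by simp
  have nonsq: "y ^ 2 \<noteq> g ^ i" if "odd i" for y :: 'a and i
  proof (cases "y = 0")
    case False
    show ?thesis
    proof
      assume "y ^ 2 = g ^ i"
      then have "g ^ (i * l) = (y ^ 2) ^ l" by (simp add: power_mult)
      also have "\<dots> = y ^ (CARD('a) - 1)" by (simp only: M power_mult)
      also have "\<dots> = 1" by (rule power_CARD_minus_1[OF False])
      finally have "2 * l dvd i * l" by (simp only: one)
      then show False using that M by simp
    qed
  qed (use g0 in simp)
  define u where "u = g"
  define v where "v = g ^ 3"
  have "u \<noteq> v"
  proof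
    assume "u = v"
    then have "g ^ 2 = 1" using g0 by (simp add: u_def v_def power2_eq_square power3_eq_cube)
    then show False using M by (auto simp: one dest: dvd_imp_le)
  qed
  have usq: "y ^ 2 \<noteq> u" and vsq: "y ^ 2 \<noteq> v" for y
    using nonsq[of 1 y] nonsq[of 3 y] by (simp_all add: u_def v_def)
  define p where "p c x = x ^ 3 - c * x" for c x :: 'a
  have pnz: "p c x \<noteq> 0" if "\<And>y. y ^ 2 \<noteq> c" "x \<noteq> 0" for c x
  proof -
    have "p c x = x * (x ^ 2 - c)" by (simp add: p_def power2_eq_square power3_eq_cube algebra_simps)
    then show ?thesis using that by simp
  qed
  have pdiff: "p c (x - y) = p c x - p c y" for c x y
  proof -
    have "(x - y) ^ 3 = x ^ 3 - y ^ 3 - 3 * (x * y * (x - y))"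
      by (simp add: power3_eq_cube algebra_simps)
    then show ?thesis using three by (simp add: p_def algebra_simps)
  qed
  define \<theta> where "\<theta> x = p u x / (v - u)" for x
  have \<theta>': "\<theta> x - x = p v x / (v - u)" for x
    using \<open>u \<noteq> v\<close> by (simp add: \<theta>_def p_def field_simps)
  have "orthomorphism \<theta>"
  proof (rule orthomorphism_additive)
    show "\<theta> (x - y) = \<theta> x - \<theta> y" for x y by (simp add: \<theta>_def pdiff diff_divide_distrib)
    show "\<theta> x \<noteq> 0" if "x \<noteq> 0" for x using pnz[OF usq that] \<open>u \<noteq> v\<close> by (simp add: \<theta>_def)
    show "\<theta> x \<noteq> x" if "x \<noteq> 0" for x using pnz[OF vsq that] \<open>u \<noteq> v\<close> \<theta>'[of x] by auto
  qed
  moreover have "unity_equivariant 2 \<theta>"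
    by (simp add: unity_equivariant_def unity_2 \<theta>_def p_def minus_divide_left)
  moreover have "\<not> unity_equivariant N \<theta>"
  proof
    assume eq: "unity_equivariant N \<theta>"
    obtain \<omega> :: 'a where \<omega>: "\<omega> \<in> unity N" "\<omega> \<notin> unity 2"
      by (rule unity_not_subset[OF g N(1), of 2]) (use N in \<open>auto dest: dvd_imp_le\<close>)
    have "\<theta> (\<omega> * 1) = \<omega> * \<theta> 1" using eq \<omega> unfolding unity_equivariant_def by blast
    then have "p u \<omega> = \<omega> * p u 1" using \<open>u \<noteq> v\<close> by (simp add: \<theta>_def)
    then have "\<omega> * (\<omega> ^ 2 - 1) = 0"
      by (simp add: p_def power2_eq_square power3_eq_cube algebra_simps)
    moreover have "\<omega> \<noteq> 0" using \<omega> N by auto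
    ultimately show False using \<omega> by (simp add: unity_def)
  qed
  ultimately show ?thesis by blast
qed

section \<open>The exceptional fields\<close>

lemma orthomorphism_apply_neq:
  assumes "orthomorphism \<theta>" "\<theta> 0 = 0" "x \<noteq> 0"
  shows "\<theta> x \<noteq> 0" "\<theta> x \<noteq> x"
proof -
  have "inj \<theta>" "inj (\<lambda>x. \<theta> x - x)" using assms(1) by (simp_all add: orthomorphism_def bij_def)
  then show "\<theta> x \<noteq> 0" "\<theta> x \<noteq> x"
    using injD[of \<theta> x 0] injD[of "\<lambda>x. \<theta> x - x" x 0] assms by auto
qed

lemma linear_if_CARD_le_4:
  fixes g :: "'a::finite_field" and \<theta> :: "'a \<Rightarrow> 'a"
  assumes g: "generates_units g" and card: "CARD('a) \<in> {3, 4}"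
    and \<theta>: "orthomorphism \<theta>" "\<theta> 0 = 0"
  shows "\<theta> x = \<theta> 1 * x"
proof -
  note neq = orthomorphism_apply_neq[OF \<theta>]
  have inj: "\<theta> y \<noteq> \<theta> z" if "y \<noteq> z" for y z
    using \<theta>(1) that by (auto simp: orthomorphism_def bij_def dest: injD)
  have g0: "g \<noteq> 0" by (rule generates_units_neq_0[OF g])
  have one: "g ^ i = 1 \<longleftrightarrow> CARD('a) - 1 dvd i" for i
    by (rule generates_units_power_eq_1_iff[OF g])
  have units: "y \<in> (\<lambda>i. g ^ i) ` {..<CARD('a) - 1}" if "y \<noteq> 0" for y
  proof -
    have "y \<in> unity (CARD('a) - 1)" using power_CARD_minus_1[OF that] by (simp add: unity_def)
    then show ?thesis using unity_eq_powers(1)[OF g, of "CARD('a) - 1"] CARD_field_ge_2[where 'a='a] by simp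
  qed
  consider "CARD('a) = 3" | "CARD('a) = 4" using card by blast
  then show ?thesis
  proof cases
    case 1
    have el: "y = 1 \<or> y = g" if "y \<noteq> 0" for y using units[OF that] 1 by (auto simp: lessThan_Suc numeral_2_eq_2)
    have g1: "g \<noteq> 1" "g * g = 1" using one[of 1] one[of 2] 1 by (auto simp: power2_eq_square)
    have "\<theta> 1 = g" "\<theta> g = 1" using neq[of 1] neq[of g] el g0 by auto
    then show ?thesis using el[of x] g1 \<theta>(2) by (cases "x = 0") auto
  next
    case 2
    have el: "y = 1 \<or> y = g \<or> y = g ^ 2" if "y \<noteq> 0" for y
      using units[OF that] 2 by (auto simp: lessThan_Suc eval_nat_numeral)
    have g1: "g \<noteq> 1" "g ^ 2 \<noteq> 1" "g ^ 3 = 1" using one[of 1] one[of 2] one[of 3] 2 by auto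
    then have g2: "g ^ 2 \<noteq> g" using g0 by (auto simp: power2_eq_square)
    have g3: "g * g ^ 2 = 1" "g ^ 2 * g = 1" "g ^ 2 * g ^ 2 = g"
      using g1(3) by (simp_all add: power2_eq_square power3_eq_cube mult_ac)
    have gg: "g * g = g ^ 2" by (simp add: power2_eq_square)
    have "g ^ 2 \<noteq> 0" using g0 by simp
    note e = el[OF neq(1)[of 1]] el[OF neq(1)[of g]] el[OF neq(1)[of "g ^ 2"]]
      neq(2)[of 1] neq(2)[of g] neq(2)[of "g ^ 2"] inj[of 1 g] inj[of 1 "g ^ 2"] inj[of g "g ^ 2"]
    \<comment> \<open>The only possibilities are multiplication by \<open>g\<close> and by
      \<open>g ^ 2\<close>.\<close>
    have "(\<theta> 1 = g \<and> \<theta> g = g ^ 2 \<and> \<theta> (g ^ 2) = 1) \<or> (\<theta> 1 = g ^ 2 \<and> \<theta> g = 1 \<and> \<theta> (g ^ 2) = g)"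
      using e g0 g1(1,2) g2 \<open>g ^ 2 \<noteq> 0\<close> by (metis zero_neq_one)
    then show ?thesis using el[of x] g3 gg \<theta>(2) by (cases "x = 0") auto
  qed
qed

section \<open>Orthomorphisms of prime fields as maps on residues\<close>

lemma of_nat_prime_field:
  fixes x :: "'a::finite_field"
  assumes "prime CARD('a)"
  shows "(of_nat i = (of_nat j :: 'a)) \<longleftrightarrow> i mod CARD('a) = j mod CARD('a)"
    and "\<exists>k<CARD('a). x = of_nat k"
proof -
  have char: "CHAR('a) = CARD('a)"
    using CHAR_dvd_CARD[where 'a='a] assms by (metis CHAR_not_1' One_nat_def prime_nat_iff)
  show eq: "(of_nat i = (of_nat j :: 'a)) \<longleftrightarrow> i mod CARD('a) = j mod CARD('a)" for i j
    using of_nat_eq_iff_cong_CHAR[where 'a='a, of i j] by (simp add: char cong_def)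
  have "inj_on (of_nat :: nat \<Rightarrow> 'a) {..<CARD('a)}"
    by (rule inj_onI) (simp add: eq)
  then have "card ((of_nat :: nat \<Rightarrow> 'a) ` {..<CARD('a)}) = CARD('a)" by (simp add: card_image)
  then have "(of_nat :: nat \<Rightarrow> 'a) ` {..<CARD('a)} = UNIV" by (intro card_subset_eq) auto
  then show "\<exists>k<CARD('a). x = of_nat k" by (metis UNIV_I imageE lessThan_iff)
qed

text \<open>Differences \<open>f i - i\<close> are compared in the form \<open>f i + j\<close>
  against \<open>f j + i\<close>, which avoids subtraction of naturals and suits evaluation.\<close>

lemma orthomorphism_of_nat:
  fixes \<theta> :: "'a::finite_field \<Rightarrow> 'a"
  assumes p: "prime CARD('a)" and \<theta>: "orthomorphism \<theta>" "\<theta> 0 = 0"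
  obtains f where "\<And>i. f i < CARD('a)" "\<And>i. \<theta> (of_nat i) = of_nat (f i)"
    "\<And>i j. i < CARD('a) \<Longrightarrow> j < CARD('a) \<Longrightarrow> i \<noteq> j \<Longrightarrow> f i \<noteq> f j"
    "\<And>i j. i < CARD('a) \<Longrightarrow> j < CARD('a) \<Longrightarrow> i \<noteq> j \<Longrightarrow> (f i + j) mod CARD('a) \<noteq> (f j + i) mod CARD('a)"
    "f 0 = 0"
proof -
  note eq = of_nat_prime_field(1)[OF p]
  obtain f where f: "\<And>i. f i < CARD('a)" "\<And>i. \<theta> (of_nat i) = of_nat (f i)"
  proof -
    have "\<forall>i. \<exists>k. k < CARD('a) \<and> \<theta> (of_nat i) = of_nat k"
      using of_nat_prime_field(2)[OF p, of "\<theta> (of_nat i)" for i] by blast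
    then show ?thesis using that by (auto simp: choice_iff)
  qed
  have inj: "inj \<theta>" "inj (\<lambda>x. \<theta> x - x)" using \<theta>(1) by (simp_all add: orthomorphism_def bij_def)
  have f0: "f 0 = 0" using f(2)[of 0] eq[of "f 0" 0] f(1)[of 0] \<theta>(2) by simp
  have ne: "of_nat i \<noteq> (of_nat j :: 'a)" if "i < CARD('a)" "j < CARD('a)" "i \<noteq> j" for i j
    using that by (simp add: eq)
  have "f i \<noteq> f j" if "i < CARD('a)" "j < CARD('a)" "i \<noteq> j" for i j
    using ne[OF that] f(2) injD[OF inj(1)] by metis
  moreover have "(f i + j) mod CARD('a) \<noteq> (f j + i) mod CARD('a)"
    if "i < CARD('a)" "j < CARD('a)" "i \<noteq> j" for i j
  proof
    assume "(f i + j) mod CARD('a) = (f j + i) mod CARD('a)"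
    then have "of_nat (f i + j) = (of_nat (f j + i) :: 'a)" by (simp only: eq)
    then have "\<theta> (of_nat i) - of_nat i = \<theta> (of_nat j) - of_nat j"
      by (simp add: f(2) algebra_simps)
    then show False using injD[OF inj(2)] ne[OF that] by blast
  qed
  ultimately show thesis using that f f0 by blast
qed

lemma orthomorphisms_mod_5:
  "\<forall>a\<in>set [0..<5]. \<forall>b\<in>set [0..<5]. \<forall>c\<in>set [0..<5]. \<forall>d\<in>set [0..<5].
    a \<noteq> 0 \<and> b \<noteq> 0 \<and> c \<noteq> 0 \<and> d \<noteq> 0 \<and> a \<noteq> 1 \<and> b \<noteq> 2 \<and> c \<noteq> 3 \<and> d \<noteq> 4 \<and>
    a \<noteq> b \<and> a \<noteq> c \<and> a \<noteq> d \<and> b \<noteq> c \<and> b \<noteq> d \<and> c \<noteq> d \<and>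
    (a + 2) mod 5 \<noteq> (b + 1) mod 5 \<and> (a + 3) mod 5 \<noteq> (c + 1) mod 5 \<and> (a + 4) mod 5 \<noteq> (d + 1) mod 5 \<and>
    (b + 3) mod 5 \<noteq> (c + 2) mod 5 \<and> (b + 4) mod 5 \<noteq> (d + 2) mod 5 \<and> (c + 4) mod 5 \<noteq> (d + 3) mod (5 :: nat) \<longrightarrow>
    b = (2 * a) mod 5 \<and> c = (3 * a) mod 5 \<and> d = (4 * a) mod 5"
  by code_simp

text \<open>The values at 1, 2, 3 determine an odd map modulo 7. The conditions on sums of two
  values compare a point with the negative of another, first for the map and then for its difference
  with the identity.\<close>

lemma odd_orthomorphisms_mod_7:
  "\<forall>a\<in>set [0..<7]. \<forall>b\<in>set [0..<7]. \<forall>c\<in>set [0..<7].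
    a \<noteq> 0 \<and> b \<noteq> 0 \<and> c \<noteq> 0 \<and> a \<noteq> 1 \<and> b \<noteq> 2 \<and> c \<noteq> 3 \<and>
    a \<noteq> b \<and> a \<noteq> c \<and> b \<noteq> c \<and> a + b \<noteq> 7 \<and> a + c \<noteq> 7 \<and> b + c \<noteq> 7 \<and>
    (a + 2) mod 7 \<noteq> (b + 1) mod 7 \<and> (a + 3) mod 7 \<noteq> (c + 1) mod 7 \<and> (b + 3) mod 7 \<noteq> (c + 2) mod 7 \<and>
    (a + b) mod 7 \<noteq> 3 \<and> (a + c) mod 7 \<noteq> 4 \<and> (b + c) mod 7 \<noteq> (5 :: nat) \<longrightarrow>
    b = (2 * a) mod 7 \<and> c = (3 * a) mod 7"
  by code_simp

lemma linear_if_CARD_5: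
  fixes \<theta> :: "'a::finite_field \<Rightarrow> 'a"
  assumes card: "CARD('a) = 5" and \<theta>: "orthomorphism \<theta>" "\<theta> 0 = 0"
  shows "\<theta> x = \<theta> 1 * x"
proof -
  have p: "prime CARD('a)" by (simp add: card)
  obtain f where f: "\<And>i. f i < CARD('a)" "\<And>i. \<theta> (of_nat i) = of_nat (f i)"
    "\<And>i j. i < CARD('a) \<Longrightarrow> j < CARD('a) \<Longrightarrow> i \<noteq> j \<Longrightarrow> f i \<noteq> f j"
    "\<And>i j. i < CARD('a) \<Longrightarrow> j < CARD('a) \<Longrightarrow> i \<noteq> j \<Longrightarrow> (f i + j) mod CARD('a) \<noteq> (f j + i) mod CARD('a)"
    "f 0 = 0"
    by (rule orthomorphism_of_nat[OF p \<theta>]) blast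
  note f = f[unfolded card]
  have lt: "f i \<in> set [0..<5]" for i using f(1)[of i] by simp
  have nz: "f i \<noteq> 0" "f i \<noteq> i" if "0 < i" "i < 5" for i
    using f(3)[of i 0] f(4)[of i 0] f(1)[of i] f(5) that by auto
  note ne = nz[of 1] nz[of 2] nz[of 3] nz[of 4]
    f(3)[of 1 2] f(3)[of 1 3] f(3)[of 1 4] f(3)[of 2 3] f(3)[of 2 4] f(3)[of 3 4]
    f(4)[of 1 2] f(4)[of 1 3] f(4)[of 1 4] f(4)[of 2 3] f(4)[of 2 4] f(4)[of 3 4]
  have "f 2 = (2 * f 1) mod 5 \<and> f 3 = (3 * f 1) mod 5 \<and> f 4 = (4 * f 1) mod 5"
    by (rule orthomorphisms_mod_5[rule_format, OF lt[of 1] lt[of 2] lt[of 3] lt[of 4]]) (intro conjI; rule ne; simp)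
  note f_eq = this
  have "f i = (i * f 1) mod 5" if "i < 5" for i
  proof -
    have "i = 0 \<or> i = 1 \<or> i = 2 \<or> i = 3 \<or> i = 4" using that by linarith
    then show ?thesis using f_eq f(5) f(1)[of 1] by (elim disjE) simp_all
  qed
  note f_lin = this
  obtain i where i: "i < 5" "x = of_nat i" using of_nat_prime_field(2)[OF p, of x] by (auto simp: card)
  have "of_nat (f i) = (of_nat (i * f 1) :: 'a)"
    using f_lin[OF i(1)] of_nat_prime_field(1)[OF p, of "f i" "i * f 1"] by (simp add: card)
  then show ?thesis using f(2)[of i] f(2)[of 1] i(2) by (simp add: mult.commute)
qed

lemma linear_if_CARD_7:
  fixes \<theta> :: "'a::finite_field \<Rightarrow> 'a"
  assumes card: "CARD('a) = 7" and \<theta>: "orthomorphism \<theta>" "\<theta> 0 = 0" and odd: "\<And>y. \<theta> (- y) = - \<theta> y"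
  shows "\<theta> x = \<theta> 1 * x"
proof -
  have p: "prime CARD('a)" by (simp add: card)
  obtain f where f: "\<And>i. f i < CARD('a)" "\<And>i. \<theta> (of_nat i) = of_nat (f i)"
    "\<And>i j. i < CARD('a) \<Longrightarrow> j < CARD('a) \<Longrightarrow> i \<noteq> j \<Longrightarrow> f i \<noteq> f j"
    "\<And>i j. i < CARD('a) \<Longrightarrow> j < CARD('a) \<Longrightarrow> i \<noteq> j \<Longrightarrow> (f i + j) mod CARD('a) \<noteq> (f j + i) mod CARD('a)"
    "f 0 = 0"
    by (rule orthomorphism_of_nat[OF p \<theta>]) blast
  note f = f[unfolded card]
  have eq: "(of_nat i = (of_nat j :: 'a)) \<longleftrightarrow> i mod 7 = j mod 7" for i j
    using of_nat_prime_field(1)[OF p, of i j] by (simp add: card)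
  have lt: "f i \<in> set [0..<7]" for i using f(1)[of i] by simp
  have nz: "f i \<noteq> 0" "f i \<noteq> i" if "0 < i" "i < 7" for i
    using f(3)[of i 0] f(4)[of i 0] f(1)[of i] f(5) that by auto
  have seven: "of_nat 7 = (0 :: 'a)" using eq[of 7 0] by simp
  have neg: "f (7 - i) = 7 - f i" if "0 < i" "i < 7" for i
  proof -
    have "of_nat (7 - i) = - (of_nat i :: 'a)"
      using that seven by (subst of_nat_diff) auto
    then have "of_nat (f (7 - i)) = - (of_nat (f i) :: 'a)" using odd[of "of_nat i"] f(2) by metis
    also have "\<dots> = of_nat (7 - f i)" using f(1)[of i] seven by (subst of_nat_diff) auto
    finally show ?thesis using f(1)[of "7 - i"] nz(1)[OF that] by (simp add: eq)
  qed
  have f6: "f 6 = 7 - f 1" "f 5 = 7 - f 2" "f 4 = 7 - f 3"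
    using neg[of 1] neg[of 2] neg[of 3] by simp_all
  have s: "f 1 + f 2 \<noteq> 7" "f 1 + f 3 \<noteq> 7" "f 2 + f 3 \<noteq> 7"
    using f(3)[of 1 5] f(3)[of 1 4] f(3)[of 2 4] f6 by auto
  have t: "(f i + f j) mod 7 \<noteq> i + j" if "0 < i" "0 < j" "i + j < 7" "i \<noteq> j" for i j
  proof
    assume "(f i + f j) mod 7 = i + j"
    then have "of_nat (f i + f j) = (of_nat (i + j) :: 'a)" using that by (simp only: eq) simp
    moreover have "of_nat (f (7 - j)) = - (of_nat (f j) :: 'a)"
    proof -
      have "of_nat (7 - f j) = - (of_nat (f j) :: 'a)" using f(1)[of j] seven by (subst of_nat_diff) auto
      then show ?thesis using neg[of j] that by simp
    qed
    moreover have "of_nat (7 - j) = - (of_nat j :: 'a)" using that seven by (subst of_nat_diff) auto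
    ultimately have "of_nat (f i + (7 - j)) = (of_nat (f (7 - j) + i) :: 'a)"
      by (simp only: of_nat_add) (simp add: algebra_simps)
    then have "(f i + (7 - j)) mod 7 = (f (7 - j) + i) mod 7" by (simp only: eq)
    moreover have "i < 7" "7 - j < 7" "i \<noteq> 7 - j" using that by linarith+
    ultimately show False using f(4)[of i "7 - j"] by blast
  qed
  have t': "(f 1 + f 2) mod 7 \<noteq> 3" "(f 1 + f 3) mod 7 \<noteq> 4" "(f 2 + f 3) mod 7 \<noteq> 5"
    using t[of 1 2] t[of 1 3] t[of 2 3] by simp_all
  note ne = nz[of 1] nz[of 2] nz[of 3] f(3)[of 1 2] f(3)[of 1 3] f(3)[of 2 3]
    f(4)[of 1 2] f(4)[of 1 3] f(4)[of 2 3] s t'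
  have "f 2 = (2 * f 1) mod 7 \<and> f 3 = (3 * f 1) mod 7"
    by (rule odd_orthomorphisms_mod_7[rule_format, OF lt[of 1] lt[of 2] lt[of 3]]) (intro conjI; rule ne; simp)
  note f_eq = this
  have "f i = (i * f 1) mod 7" if "i < 4" for i
  proof -
    have "i = 0 \<or> i = 1 \<or> i = 2 \<or> i = 3" using that by linarith
    then show ?thesis using f_eq f(5) f(1)[of 1] by (elim disjE) simp_all
  qed
  note f_lin = this
  have *: "\<theta> (of_nat i) = \<theta> 1 * of_nat i" if "i < 4" for i
  proof -
    have "of_nat (f i) = (of_nat (i * f 1) :: 'a)" unfolding eq f_lin[OF that] by simp
    then show ?thesis using f(2)[of i] f(2)[of 1] by (simp add: mult.commute)
  qed
  obtain i where i: "i < 7" "x = of_nat i" using of_nat_prime_field(2)[OF p, of x] by (auto simp: card)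
  show ?thesis
  proof (cases "i < 4")
    case False
    have "x = - of_nat (7 - i)" using i seven by (subst of_nat_diff) auto
    then show ?thesis using odd[of "of_nat (7 - i)"] *[of "7 - i"] False by simp
  qed (use * i in simp)
qed

section \<open>Separating cyclotomic orthomorphisms of different indices\<close>

lemma even_CARD_imp_two_eq_0:
  assumes "primepow CARD('a::finite_field)" "even CARD('a)"
  shows "(2 :: 'a) = 0"
proof -
  obtain p k where p: "prime p" "CARD('a) = p ^ k" using assms(1) by (auto simp: primepow_def)
  then have "even p" using assms(2) by (metis even_power)
  then have "p = 2" using p(1) by (metis primes_dvd_imp_eq two_is_prime_nat)
  then have "(of_nat 2 :: 'a) ^ k = of_nat CARD('a)" by (simp only: p(2) of_nat_power)
  then show ?thesis by simp
qed

text \<open>Since \<open>p - 1\<close> divides \<open>p ^ k - 1 = 2 * t\<close>, the number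
  \<open>(p - 1) / 2\<close> divides the prime \<open>t\<close>, and it is not 1 because
  \<open>p \<ge> 5\<close>.\<close>

lemma power_prime_eq_double_prime_plus_1:
  fixes p k t :: nat
  assumes p: "p ^ k = 2 * t + 1" "p \<ge> 5" and t: "prime t"
  shows "p ^ k = p"
proof -
  have "odd (p ^ k)" using p by simp
  then have "odd p \<or> k = 0" by simp
  moreover have "k \<noteq> 0" using p t by (auto intro!: Nat.gr0I)
  ultimately obtain u where u: "p = 2 * u + 1" by (auto elim: oddE)
  have "[p = 1] (mod (p - 1))" using p by (simp add: cong_altdef_nat)
  then have "[p ^ k = 1 ^ k] (mod (p - 1))" by (rule cong_pow)
  then have "p - 1 dvd p ^ k - 1" using p by (simp add: cong_altdef_nat)
  then have "u dvd t" using u p by simp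
  then have "u = t" using t u p by (auto simp: prime_nat_iff)
  then show ?thesis using u p by simp
qed

lemma exists_separating_odd_orthomorphism_maximal:
  fixes g :: "'a::finite_field" and t :: nat
  assumes g: "generates_units g" and pp: "primepow CARD('a)"
    and card: "CARD('a) = 2 * t + 1" and t: "prime t" "t > 3"
  shows "\<exists>\<theta> :: 'a \<Rightarrow> 'a. orthomorphism \<theta> \<and> unity_equivariant 2 \<theta> \<and> \<not> unity_equivariant (2 * t) \<theta>"
proof -
  have M: "CARD('a) - 1 = 2 * t" using card by simp
  obtain p k where p: "prime p" "CARD('a) = p ^ k" using pp by (auto simp: primepow_def)
  have p0: "of_nat p = (0 :: 'a)"
  proof -
    have "(of_nat p :: 'a) ^ k = of_nat CARD('a)" by (simp only: p(2) of_nat_power)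
    then show ?thesis by simp
  qed
  have two: "(2 :: 'a) \<noteq> 0"
  proof -
    have "2 dvd CARD('a) - 1" unfolding M by simp
    from of_nat_dvd_CARD_minus_1_neq_0[OF this] show ?thesis by simp
  qed
  have "p \<noteq> 2" using p0 two by auto
  show ?thesis
  proof (cases "p = 3")
    case True
    then have "(3 :: 'a) = 0" using p0 by simp
    then show ?thesis
      by (rule exists_orthomorphism_char_3[OF g _ M]) (use t M in auto)
  next
    case False
    have "p \<ge> 2" using p(1) by (rule prime_ge_2_nat)
    moreover have "p \<noteq> 4" using p(1) by auto
    ultimately have "p \<ge> 5" using \<open>p \<noteq> 2\<close> False by linarith
    then have "p ^ k = p" using power_prime_eq_double_prime_plus_1[of p k t] p(2) card t by simp
    then have prime: "prime CARD('a)" using p by simp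
    have "odd t" using t prime_odd_nat by auto
    then obtain \<theta> :: "'a \<Rightarrow> 'a" where \<theta>: "orthomorphism \<theta>" "\<And>y. \<theta> (- y) = - \<theta> y"
      "\<not> (\<forall>y. \<theta> y = \<theta> 1 * y)"
      using exists_nonlinear_odd_orthomorphism_prime[OF g card prime _ t(2)] by blast
    have "2 * \<theta> 0 = 0" using \<theta>(2)[of 0] by (simp add: eq_neg_iff_add_eq_0)
    then have zero: "\<theta> 0 = 0" using two by simp
    have "unity_equivariant 2 \<theta>" using zero \<theta>(2) by (simp add: unity_equivariant_def unity_2)
    moreover have "\<not> unity_equivariant (2 * t) \<theta>"
    proof
      assume eq: "unity_equivariant (2 * t) \<theta>"
      have "\<theta> y = \<theta> 1 * y" for y
      proof (cases "y = 0")
        case False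
        then have "y \<in> unity (2 * t)" using power_CARD_minus_1[OF False] M by (simp add: unity_def)
        then have "\<theta> (y * 1) = y * \<theta> 1" using eq unfolding unity_equivariant_def by blast
        then show ?thesis by (simp add: mult.commute)
      qed (simp add: zero)
      then show False using \<theta>(3) by blast
    qed
    ultimately show ?thesis using \<theta>(1) by blast
  qed
qed

text \<open>If \<open>q - 1\<close> has no proper divisor \<open>m \<ge> 3\<close>, then either
  \<open>q - 1\<close> is 2 or 4, where every \<open>N\<close> is excluded, or \<open>q - 1\<close>
  is odd and equal to \<open>N\<close>, which is the case of characteristic 2.\<close>

lemma exists_separating_orthomorphism_free:
  fixes g :: "'a::finite_field"
  assumes g: "generates_units g" and pp: "primepow CARD('a)"
    and N: "N dvd CARD('a) - 1" "N \<ge> 2"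
    and exc: "(CARD('a), N) \<notin> {(3, 2), (4, 3), (5, 4), (5, 2)}"
  shows "\<exists>\<theta> :: 'a \<Rightarrow> 'a. orthomorphism \<theta> \<and> unity_equivariant 1 \<theta> \<and> \<not> unity_equivariant N \<theta>"
proof (cases "\<exists>m. m dvd CARD('a) - 1 \<and> m \<ge> 3 \<and> m < CARD('a) - 1")
  case True
  then show ?thesis using exists_orthomorphism_switch_shifted[OF g _ _ _ N] by blast
next
  case False
  define M where "M = CARD('a) - 1"
  have card: "CARD('a) = M + 1" using CARD_field_ge_2[where 'a='a] by (simp add: M_def)
  have small: "m < 3 \<or> m \<ge> M" if "m dvd M" for m using False that unfolding M_def by (meson not_less)
  have NM: "N dvd M" "N \<le> M" using N CARD_field_ge_2[where 'a='a] by (auto simp: M_def intro: dvd_imp_le)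
  show ?thesis
  proof (cases "even M")
    case True
    then obtain k where k: "M = 2 * k" by (auto elim: evenE)
    then have "k < 3" using small[of k] NM N by auto
    then have "M = 2 \<or> M = 4" using k NM N by auto
    moreover have "N = 2 \<or> N = 4" if "M = 4"
    proof -
      have "N \<noteq> 3" using NM that by auto
      then show ?thesis using NM that N by linarith
    qed
    ultimately show ?thesis using exc card NM N by auto
  next
    case False
    then have "odd N" using NM by (auto elim: dvd_trans)
    then have "N \<noteq> 2" by auto
    then have "N = M" using small[OF NM(1)] NM N by linarith
    have "M \<noteq> 3" using exc card \<open>N = M\<close> by auto
    moreover have "M \<noteq> 4" using False by auto
    ultimately have "CARD('a) > 4" using card \<open>N = M\<close> N \<open>N \<noteq> 2\<close> by linarith
    moreover have "(2 :: 'a) = 0" by (rule even_CARD_imp_two_eq_0[OF pp]) (use False card in simp)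
    ultimately show ?thesis
      using exists_nonlinear_orthomorphism_char_2[OF g] \<open>N = M\<close> by (simp add: M_def)
  qed
qed

lemma exists_separating_orthomorphism_odd:
  fixes g :: "'a::finite_field"
  assumes g: "generates_units g" and pp: "primepow CARD('a)"
    and N: "N dvd CARD('a) - 1" "2 dvd N" "N > 2"
    and exc: "(CARD('a), N) \<notin> {(5, 4), (7, 6)}"
  shows "\<exists>\<theta> :: 'a \<Rightarrow> 'a. orthomorphism \<theta> \<and> unity_equivariant 2 \<theta> \<and> \<not> unity_equivariant N \<theta>"
proof (cases "\<exists>m. 2 dvd m \<and> m dvd CARD('a) - 1 \<and> m \<ge> 3 \<and> \<not> N dvd m")
  case True
  then obtain m where m: "2 dvd m" "m dvd CARD('a) - 1" "m \<ge> 3" "\<not> N dvd m" by blast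
  then show ?thesis
    using exists_orthomorphism_switch_coset[OF g m(2,3) N(1) m(4)] unity_equivariant_mono by blast
next
  case False
  obtain t where t: "N = 2 * t" using N(2) by (auto elim: dvdE)
  then have t2: "t \<ge> 2" using N by simp
  obtain s where "CARD('a) - 1 = N * s" using N(1) by (auto elim: dvdE)
  then have M: "CARD('a) - 1 = 2 * (t * s)" using t by simp
  then have card: "CARD('a) = 2 * (t * s) + 1" using CARD_field_ge_2[where 'a='a] by linarith
  have s0: "s > 0" using card CARD_field_ge_2[where 'a='a] by (auto intro: gr0I)
  \<comment> \<open>No even \<open>m \<ge> 3\<close> dividing \<open>q - 1\<close> avoids being a
    multiple of \<open>N\<close>; so \<open>t\<close> divides every nontrivial divisor of
    \<open>t * s\<close>. Hence \<open>t\<close> is prime if \<open>s = 1\<close>, and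
    \<open>t\<close> divides \<open>s\<close> otherwise.\<close>
  have D: "t dvd d" if "d dvd t * s" "d \<ge> 2" for d
  proof -
    have "2 * d dvd CARD('a) - 1" using that(1) unfolding M by simp
    moreover have "2 * d \<ge> 3" "2 dvd 2 * d" using that(2) by simp_all
    ultimately have "N dvd 2 * d" using False by blast
    then show ?thesis by (simp add: t)
  qed
  have two: "(2 :: 'a) \<noteq> 0"
  proof -
    have "2 dvd CARD('a) - 1" unfolding M by simp
    from of_nat_dvd_CARD_minus_1_neq_0[OF this] show ?thesis by simp
  qed
  show ?thesis
  proof (cases "s = 1")
    case True
    have "prime t"
      unfolding prime_nat_iff
    proof (intro conjI allI impI)
      fix d assume "d dvd t"
      then have "d > 0" "d \<le> t" using t2 by (auto intro: gr0I dvd_imp_le)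
      show "d = 1 \<or> d = t"
      proof (cases "d \<ge> 2")
        case True
        then have "t dvd d" using D \<open>d dvd t\<close> by simp
        then show ?thesis using \<open>d dvd t\<close> by (simp add: dvd_antisym)
      qed (use \<open>d > 0\<close> in linarith)
    qed (use t2 in simp)
    moreover have "t \<noteq> 2" "t \<noteq> 3" using exc card t True by auto
    ultimately show ?thesis
      using exists_separating_odd_orthomorphism_maximal[OF g pp, of t] card t True t2 by simp
  next
    case False
    then have "t dvd s" using D[of s] s0 by simp
    \<comment> \<open>The shift \<open>z\<close> must avoid 0 and all midpoints of two
      \<open>m\<close>-th roots of unity, so it suffices that these do not fill the field.\<close>
    have switch: ?thesis if m: "m dvd N" "m \<ge> 3"
      and c: "card (insert 0 ((\<lambda>(k, k'). (k + k') / 2) ` (unity m \<times> unity m)) :: 'a set) < CARD('a)" for m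
    proof -
      obtain z :: 'a where z: "z \<notin> insert 0 ((\<lambda>(k, k'). (k + k') / 2) ` (unity m \<times> unity m))"
        using exists_not_in_small[OF c] .
      show ?thesis
      proof (rule exists_orthomorphism_switch_shifted_odd[OF g two dvd_trans[OF m(1) N(1)] m(2) N(1) m(1)])
        show "z \<noteq> 0" using z by auto
        show "2 * z \<noteq> k + k'" if "k \<in> unity m" "k' \<in> unity m" for k k'
        proof
          assume "2 * z = k + k'"
          then have "z = (\<lambda>(k, k'). (k + k') / 2) (k, k')" using two by (simp add: field_simps)
          moreover have "(k, k') \<in> unity m \<times> unity m" using that by simp
          ultimately show False using z by blast
        qed
      qed
    qed
    have cardK: "card ((\<lambda>(k, k'). (k + k') / 2) ` (unity m \<times> unity m) :: 'a set) \<le> m * m" if "m dvd N" for m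
    proof -
      have "card ((\<lambda>(k, k'). (k + k') / 2) ` (unity m \<times> unity m) :: 'a set) \<le> card (unity m \<times> unity m :: ('a \<times> 'a) set)"
        by (rule card_image_le) simp
      then show ?thesis
        using unity_eq_powers(2)[OF g dvd_trans[OF that N(1)]] by (simp add: card_cartesian_product)
    qed
    show ?thesis
    proof (cases "t = 2")
      case True
      obtain j where j: "s = 2 * j" using \<open>t dvd s\<close> True by (auto elim: dvdE)
      show ?thesis
      proof (cases "j = 1")
        case True
        then have "CARD('a) = 9" using card j \<open>t = 2\<close> by simp
        then have "of_nat 9 = (0 :: 'a)" using of_nat_CARD[where 'a='a] by simp
        then have "(3 :: 'a) * 3 = 0" by simp
        then have "(3 :: 'a) = 0" by (metis mult_eq_0_iff)
        then show ?thesis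
          by (rule exists_orthomorphism_char_3[OF g _ M]) (use N j True \<open>t = 2\<close> in auto)
      next
        case False
        then have "j \<ge> 2" using j s0 by auto
        then have "CARD('a) \<ge> 17" using card j True by simp
        have "4 dvd N" using t True by simp
        \<comment> \<open>With \<open>q \<ge> 17\<close> there is room for the at most 16 midpoints
          but none to spare; 0 is not an additional point, being the midpoint of 1 and -1.\<close>
        have "(1, -1 :: 'a) \<in> unity 4 \<times> unity 4" by (simp add: unity_def)
        then have "(\<lambda>(k, k'). (k + k') / 2) (1, -1) \<in> (\<lambda>(k, k'). (k + k') / 2) ` (unity 4 \<times> unity 4 :: ('a \<times> 'a) set)"
          by (rule imageI)
        then have "0 \<in> (\<lambda>(k, k'). (k + k') / 2) ` (unity 4 \<times> unity 4 :: ('a \<times> 'a) set)" by simp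
        then show ?thesis
          using cardK[OF \<open>4 dvd N\<close>] \<open>CARD('a) \<ge> 17\<close>
          by (intro switch[OF \<open>4 dvd N\<close>]) (simp_all add: insert_absorb)
      qed
    next
      case False
      have "t dvd N" using t by simp
      have "s \<ge> t" using \<open>t dvd s\<close> s0 by (auto intro: dvd_imp_le)
      then have "t * t \<le> t * s" by simp
      then have "t * t + 1 < CARD('a)" using card s0 t2 by (smt (verit) mult_pos_pos not_numeral_le_zero gr0I mult_2 less_add_same_cancel1 add_less_mono1 order_le_less_trans)
      moreover have "card (insert 0 ((\<lambda>(k, k'). (k + k') / 2) ` (unity t \<times> unity t)) :: 'a set) \<le> t * t + 1"
        using card_insert_le_m1 cardK[OF \<open>t dvd N\<close>] by (simp add: card_insert_if)
      ultimately show ?thesis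
        using t2 False by (intro switch[OF \<open>t dvd N\<close>]) simp_all
    qed
  qed
qed

lemma exists_separating_orthomorphism:
  fixes g :: "'a::finite_field"
  assumes g: "generates_units g" and pp: "primepow CARD('a)"
    and N: "N dvd CARD('a) - 1" and n: "n dvd N" "n < N" "n > 0"
    and exc: "(CARD('a), N, n) \<notin> {(3, 2, 1), (4, 3, 1), (5, 4, 2), (5, 4, 1), (5, 2, 1), (7, 6, 2)}"
  shows "\<exists>\<theta> :: 'a \<Rightarrow> 'a. orthomorphism \<theta> \<and> unity_equivariant n \<theta> \<and> \<not> unity_equivariant N \<theta>"
proof -
  consider "n = 1" | "n = 2" | "n \<ge> 3" using n(3) by linarith
  then show ?thesis
  proof cases
    case 1
    then show ?thesis using exists_separating_orthomorphism_free[OF g pp N] n exc by auto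
  next
    case 2
    then show ?thesis using exists_separating_orthomorphism_odd[OF g pp N] n exc by auto
  next
    case 3
    have "\<not> N dvd n" using n by (auto dest: dvd_imp_le)
    then show ?thesis using exists_orthomorphism_switch_coset[OF g _ 3 N] dvd_trans[OF n(1) N] by blast
  qed
qed

theorem theorem3p1:
  fixes g :: "'a::finite_field" and q a b :: nat
  assumes "primepow q" and "CARD('a) = q"
    and "generates_units g"
    and "a > 0" and "b > 0" and "a \<noteq> b"
    and "a dvd b" and "b dvd (q - 1)"
  shows "cyclotomic_orthomorphisms g a = cyclotomic_orthomorphisms g b \<longleftrightarrow>
    (q, a, b) \<in> {(3, 1, 2), (4, 1, 3), (5, 1, 2), (5, 1, 4), (5, 2, 4), (7, 1, 3)}"
proof -
  note g = assms(3)
  define n where "n = (CARD('a) - 1) div b"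
  define N where "N = (CARD('a) - 1) div a"
  have bM: "b dvd CARD('a) - 1" using assms by simp
  then have aM: "a dvd CARD('a) - 1" using assms(7) by (rule dvd_trans[rotated])
  have M: "CARD('a) - 1 = b * n" "CARD('a) - 1 = a * N" using aM bM by (simp_all add: n_def N_def)
  have M0: "CARD('a) - 1 > 0" using CARD_field_ge_2[where 'a='a] by simp
  then have n0: "n > 0" using M by (cases n) auto
  obtain t where t: "b = a * t" using assms(7) by (auto elim: dvdE)
  then have "t \<noteq> 1" "t > 0" using assms by (auto intro: gr0I)
  have "a * N = a * (t * n)" unfolding M(2)[symmetric] M(1) t by (rule mult.assoc)
  then have Nt: "N = t * n" using assms(4) by auto
  have n: "n dvd N" "n < N" using Nt n0 \<open>t \<noteq> 1\<close> \<open>t > 0\<close> by auto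
  have C: "cyclotomic_orthomorphisms g b = {\<theta>. orthomorphism \<theta> \<and> unity_equivariant n \<theta>}"
    "cyclotomic_orthomorphisms g a = {\<theta>. orthomorphism \<theta> \<and> unity_equivariant N \<theta>}"
    using cyclotomic_orthomorphisms_eq[OF g bM] cyclotomic_orthomorphisms_eq[OF g aM]
    by (simp_all add: n_def N_def)
  show ?thesis
  proof
    assume eq: "cyclotomic_orthomorphisms g a = cyclotomic_orthomorphisms g b"
    have "(CARD('a), N, n) \<in> {(3, 2, 1), (4, 3, 1), (5, 4, 2), (5, 4, 1), (5, 2, 1), (7, 6, 2)}"
    proof (rule ccontr)
      assume "\<not> ?thesis"
      moreover have "primepow CARD('a)" using assms(1,2) by simp
      moreover have "N dvd CARD('a) - 1" unfolding M(2) by simp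
      ultimately obtain \<theta> :: "'a \<Rightarrow> 'a" where \<theta>: "orthomorphism \<theta>" "unity_equivariant n \<theta>" "\<not> unity_equivariant N \<theta>"
        using exists_separating_orthomorphism[OF g _ _ n n0] by blast
      then have "\<theta> \<in> cyclotomic_orthomorphisms g b" unfolding C by simp
      then have "\<theta> \<in> cyclotomic_orthomorphisms g a" using eq by simp
      then show False using \<theta>(3) unfolding C by simp
    qed
    then consider "CARD('a) = 3" "N = 2" "n = 1" | "CARD('a) = 4" "N = 3" "n = 1"
      | "CARD('a) = 5" "N = 4" "n = 2" | "CARD('a) = 5" "N = 4" "n = 1"
      | "CARD('a) = 5" "N = 2" "n = 1" | "CARD('a) = 7" "N = 6" "n = 2"
      by blast
    then show "(q, a, b) \<in> {(3, 1, 2), (4, 1, 3), (5, 1, 2), (5, 1, 4), (5, 2, 4), (7, 1, 3)}"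
      by cases (use M assms(2) in simp_all)
  next
    assume exc: "(q, a, b) \<in> {(3, 1, 2), (4, 1, 3), (5, 1, 2), (5, 1, 4), (5, 2, 4), (7, 1, 3)}"
    \<comment> \<open>In each exceptional case all \<open>n\<close>-equivariant orthomorphisms are
      linear, hence equivariant under every root of unity. For \<open>q = 7\<close> this uses
      oddness, as \<open>n = 2\<close>.\<close>
    have lin: "\<theta> x = \<theta> 1 * x" if \<theta>: "orthomorphism \<theta>" "unity_equivariant n \<theta>" for \<theta> :: "'a \<Rightarrow> 'a" and x
    proof -
      have zero: "\<theta> 0 = 0" using \<theta>(2) by (simp add: unity_equivariant_def)
      consider "CARD('a) \<in> {3, 4}" | "CARD('a) = 5" | "CARD('a) = 7" "b = 3"
        using exc assms(2) by auto
      then show ?thesis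
      proof cases
        case 1
        then show ?thesis using linear_if_CARD_le_4[OF g _ \<theta>(1) zero] by blast
      next
        case 2
        then show ?thesis using linear_if_CARD_5[OF _ \<theta>(1) zero] by blast
      next
        case 3
        then have "n = 2" using M(1) by simp
        then have "\<theta> (- y) = - \<theta> y" for y
          using \<theta>(2) by (simp add: unity_equivariant_def unity_2)
        then show ?thesis using linear_if_CARD_7[OF 3(1) \<theta>(1) zero] by blast
      qed
    qed
    have "unity_equivariant N \<theta>" if "orthomorphism \<theta>" "unity_equivariant n \<theta>" for \<theta> :: "'a \<Rightarrow> 'a"
      unfolding unity_equivariant_def
    proof (intro conjI ballI allI)
      show "\<theta> 0 = 0" using that(2) by (simp add: unity_equivariant_def)
      show "\<theta> (\<omega> * x) = \<omega> * \<theta> x" for \<omega> x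
        using lin[OF that, of "\<omega> * x"] lin[OF that, of x] by simp
    qed
    then show "cyclotomic_orthomorphisms g a = cyclotomic_orthomorphisms g b"
      unfolding C using unity_equivariant_mono[OF _ n(1)] by blast
  qed
qed

end
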